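(* Let $f:\mathbb{A}\to\mathbb{A}$ be a $C^1$ positive twist map and let $(f_t)_{t\in[0,1]}$ be an isotopy in $\mathrm{Diff}^1(\mathbb{A})$ joining the identity to $f_1=f$. Then, for any point $z\in\mathbb{A}$ for which the limit defining the torsion exists, $$\mathrm{Torsion}((f_t)_t,z)\in[-\pi,0].$$
   Context: $\mathbb{T}=\mathbb{R}/2\pi\mathbb{Z}$ and $\mathbb{A}=\mathbb{T}\times\mathbb{R}$, with universal cover $\mathbb{R}^2\to\mathbb{A}$, $(x,y)\mapsto(x \bmod 2\pi,y)$, the standard flat metric, the standard trivialization of the tangent bundle and the counterclockwise orientation. An isotopy joining $\mathrm{Id}$ to $f$ is a path $(f_t)_{t\in[0,1]}$ in $\mathrm{Diff}^1(\mathbb{A})$, continuous for the weak (compact-open) $C^1$ topology, with $f_0=\mathrm{Id}$, $f_1=f$; it is extended to $t\ge 0$ by $f_t=f_{\{t\}}\circ f^{\lfloor t\rfloor}$, where $\{t\}$ is the fractional part and $\lfloor t\rfloor$ the integer part of $t$. A positive twist map is a $C^1$ diffeomorphism $f:\mathbb{A}\to\mathbb{A}$ isotopic to the identity such that for any lift $F:\mathbb{R}^2\to\mathbb{R}^2$ of $f$ and any $x\in\mathbb{R}$, the function $\mathbb{R}\ni y\mapsto p_1\circ F(x,y)\in\mathbb{R}$ is an increasing diffeomorphism of $\mathbb{R}$, where $p_1:\mathbb{R}^2\to\mathbb{R}$ is the first coordinate projection. For $z\in\mathbb{A}$, $\xi\in T_z\mathbb{A}\setminus\{0\}$, let $\tilde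 v$ be a continuous lift to $\mathbb{R}$ of the function $t\mapsto\theta((0,1),Df_t(z)\xi)\in\mathbb{T}$, $t\geq 0$, where $\theta(u,w)\in\mathbb{T}$ denotes the oriented angle from $u$ to $w$. Then $\mathrm{Torsion}_n((f_t)_t,z,\xi)=\frac1n(\tilde v(n)-\tilde v(0))$ for $n\ge1$. If $\mathrm{Torsion}_n((f_t)_t,z,\xi)$ converges as $n\to+\infty$ for some $\xi\in T_z\mathbb{A}\setminus\{0\}$, then $\mathrm{Torsion}((f_t)_t,z)$ is defined as this limit (existence and value of the limit do not depend on $\xi$). *)

theory Defs
  imports "HOL-Analysis.Analysis"
begin

text \<open>The circle \<open>\<real>/2\<pi>\<int>\<close>, with the quotient metric; \<open>abs_circle\<close> is the projection.\<close>

quotient_type circle = real / "\<lambda>x y. \<exists>k::int. x = y + 2 * pi * of_int k"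
proof (rule equivpI)
  show "reflp (\<lambda>x y. \<exists>k::int. x = y + 2 * pi * of_int k)"
    by (rule reflpI, rule exI[of _ 0]) simp
  show "symp (\<lambda>x y. \<exists>k::int. x = y + 2 * pi * of_int k)"
  proof (rule sympI, elim exE)
    fix x y :: real and k :: int
    assume "x = y + 2 * pi * of_int k"
    then show "\<exists>k::int. y = x + 2 * pi * of_int k"
      by (intro exI[of _ "-k"]) simp
  qed
  show "transp (\<lambda>x y. \<exists>k::int. x = y + 2 * pi * of_int k)"
  proof (rule transpI, elim exE)
    fix x y z :: real and k l :: int
    assume "x = y + 2 * pi * of_int k" "y = z + 2 * pi * of_int l"
    then show "\<exists>k::int. x = z + 2 * pi * of_int k"
      by (intro exI[of _ "k + l"]) (simp add: algebra_simps)
  qed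
qed

lemma abs_circle_eq_iff: "abs_circle x = abs_circle y \<longleftrightarrow> (\<exists>k::int. x = y + 2 * pi * of_int k)"
  by (rule circle.abs_eq_iff)

lemma abs_circle_surj: "\<exists>x. abs_circle x = a"
  using Quotient3_abs_rep[OF Quotient3_circle] by blast

instantiation circle :: metric_space
begin

definition dist_circle :: "circle \<Rightarrow> circle \<Rightarrow> real" where
  "dist_circle a b = Inf {\<bar>x - y\<bar> | x y. abs_circle x = a \<and> abs_circle y = b}"

definition uniformity_circle :: "(circle \<times> circle) filter" where
  "uniformity_circle = (INF e\<in>{0 <..}. principal {(a, b). dist a b < e})"

definition open_circle :: "circle set \<Rightarrow> bool" where
  "open_circle U \<longleftrightarrow> (\<forall>a\<in>U. eventually (\<lambda>(a', b). a' = a \<longrightarrow> b \<in> U) uniformity)"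

instance
proof
  have bdd: "bdd_below {\<bar>x - y\<bar> | x y. abs_circle x = a \<and> abs_circle y = b}" for a b
    by (rule bdd_belowI[of _ 0]) auto
  have ne: "{\<bar>x - y\<bar> | x y. abs_circle x = a \<and> abs_circle y = b} \<noteq> {}" for a b
    using abs_circle_surj[of a] abs_circle_surj[of b] by auto
  have le: "dist (abs_circle x) (abs_circle y) \<le> \<bar>x - y\<bar>" for x y
    unfolding dist_circle_def by (rule cInf_lower[OF _ bdd]) auto
  have lt: "\<exists>x y. abs_circle x = a \<and> abs_circle y = b \<and> \<bar>x - y\<bar> < e"
    if "dist a b < e" for a b e
    using that unfolding dist_circle_def cInf_less_iff[OF ne bdd] by auto
  have nonneg: "0 \<le> dist a b" for a b :: circle
    unfolding dist_circle_def by (rule cInf_greatest[OF ne]) auto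
  show "dist a b = 0 \<longleftrightarrow> a = b" for a b :: circle
  proof
    assume "a = b"
    then show "dist a b = 0"
      using abs_circle_surj[of a] le[of _ _] nonneg[of a b] by (metis abs_zero antisym diff_self)
  next
    assume d: "dist a b = 0"
    then obtain x y where xy: "abs_circle x = a" "abs_circle y = b" "\<bar>x - y\<bar> < pi"
      using lt[of a b pi] by auto
    show "a = b"
    proof (rule ccontr)
      assume "a \<noteq> b"
      then have "x \<noteq> y" using xy by auto
      then obtain x' y' where xy': "abs_circle x' = a" "abs_circle y' = b" "\<bar>x' - y'\<bar> < \<bar>x - y\<bar>"
        using lt[of a b "\<bar>x - y\<bar>"] d by auto
      obtain k l :: int where k: "x' = x + 2 * pi * of_int k" and l: "y' = y + 2 * pi * of_int l"
        using xy xy' by (metis abs_circle_eq_iff)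
      have eq: "(x' - y') - (x - y) = 2 * pi * of_int (k - l)"
        using k l by (simp add: algebra_simps)
      have "\<bar>2 * pi * of_int (k - l)\<bar> < 2 * pi"
        using xy xy' unfolding eq[symmetric] by linarith
      then have "\<bar>real_of_int (k - l)\<bar> < 1"
        by (simp add: abs_mult)
      then have "k = l" by linarith
      then show False using eq xy' by simp
    qed
  qed
  show "dist a b \<le> dist a c + dist b c" for a b c :: circle
  proof (rule field_le_epsilon)
    fix e :: real assume "0 < e"
    then obtain x z y z' where x: "abs_circle x = a" "abs_circle z = c" "\<bar>x - z\<bar> < dist a c + e / 2"
      and y: "abs_circle y = b" "abs_circle z' = c" "\<bar>y - z'\<bar> < dist b c + e / 2"
      using lt[of a c "dist a c + e / 2"] lt[of b c "dist b c + e / 2"] by auto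
    obtain k :: int where k: "z = z' + 2 * pi * of_int k"
      using x y by (metis abs_circle_eq_iff)
    have "abs_circle (y + 2 * pi * of_int k) = b"
      using y(1) abs_circle_eq_iff by blast
    then have "dist a b \<le> \<bar>x - (y + 2 * pi * of_int k)\<bar>"
      using le x(1) by blast
    also have "\<dots> \<le> \<bar>x - z\<bar> + \<bar>y - z'\<bar>"
      unfolding k by linarith
    finally show "dist a b \<le> dist a c + dist b c + e"
      using x(3) y(3) by linarith
  qed
qed (simp_all add: uniformity_circle_def open_circle_def)

end

text \<open>The product metric on the annulus is the standard flat one.\<close>

type_synonym annulus = "circle \<times> real"

definition annulus_proj :: "real \<times> real \<Rightarrow> annulus" where
  "annulus_proj p = (abs_circle (fst p), snd p)"

definition is_lift :: "(real \<times> real \<Rightarrow> real \<times> real) \<Rightarrow> (annulus \<Rightarrow> annulus) \<Rightarrow> bool" where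
  "is_lift F f \<longleftrightarrow> continuous_on UNIV F \<and> (\<forall>p. annulus_proj (F p) = f (annulus_proj p))"

text \<open>
  The differential of \<open>f\<close> at \<open>z\<close> in the standard trivialization. The covering projection restricts
  to charts, so this is the derivative of a local lift of \<open>f\<close> near a point \<open>p\<close> above \<open>z\<close>. Only the
  germ of \<open>G\<close> at \<open>p\<close> matters: \<open>G\<close> is a set-theoretic lift, not required to be continuous away
  from \<open>p\<close>, so that no global lift of \<open>f\<close> is presupposed.
\<close>

definition has_annulus_derivative ::
  "(annulus \<Rightarrow> annulus) \<Rightarrow> ((real \<times> real) \<Rightarrow>\<^sub>L (real \<times> real)) \<Rightarrow> annulus \<Rightarrow> bool" where
  "has_annulus_derivative f D z \<longleftrightarrow>
    (\<exists>p G. annulus_proj p = z \<and> (\<forall>q. annulus_proj (G q) = f (annulus_proj q)) \<and>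
      (G has_derivative blinfun_apply D) (at p))"

definition annulus_deriv ::
  "(annulus \<Rightarrow> annulus) \<Rightarrow> annulus \<Rightarrow> (real \<times> real) \<Rightarrow>\<^sub>L (real \<times> real)" where
  "annulus_deriv f z = (THE D. has_annulus_derivative f D z)"

definition C1_annulus_map :: "(annulus \<Rightarrow> annulus) \<Rightarrow> bool" where
  "C1_annulus_map f \<longleftrightarrow>
    (\<exists>f'. (\<forall>z. has_annulus_derivative f (f' z) z) \<and> continuous_on UNIV f')"

definition Diff1_annulus :: "(annulus \<Rightarrow> annulus) set" where
  "Diff1_annulus = {f. bij f \<and> C1_annulus_map f \<and> C1_annulus_map (inv f)}"

text \<open>
  The weak topology has carrier \<open>Diff1_annulus\<close> (take \<open>K = {}\<close> below). On compact \<open>K\<close> the pointwise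
  strict bounds are bounds on the maxima, so this is uniform convergence on compact sets of the
  maps and of their differentials.
\<close>

definition weak_C1_topology :: "(annulus \<Rightarrow> annulus) topology" where
  "weak_C1_topology = topology_generated_by
    {{g \<in> Diff1_annulus. \<forall>z\<in>K. dist (f z) (g z) < e \<and>
        norm (annulus_deriv f z - annulus_deriv g z) < e} | f K e.
      f \<in> Diff1_annulus \<and> compact K \<and> 0 < e}"

definition isotopy_from_id :: "(real \<Rightarrow> annulus \<Rightarrow> annulus) \<Rightarrow> (annulus \<Rightarrow> annulus) \<Rightarrow> bool" where
  "isotopy_from_id \<phi> f \<longleftrightarrow> pathin weak_C1_topology \<phi> \<and> \<phi> 0 = id \<and> \<phi> 1 = f"

definition isotopy_extension :: "(real \<Rightarrow> annulus \<Rightarrow> annulus) \<Rightarrow> real \<Rightarrow> annulus \<Rightarrow> annulus" where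
  "isotopy_extension \<phi> t = \<phi> (frac t) \<circ> (\<phi> 1 ^^ nat \<lfloor>t\<rfloor>)"

definition increasing_diffeo :: "(real \<Rightarrow> real) \<Rightarrow> bool" where
  "increasing_diffeo g \<longleftrightarrow> strict_mono g \<and> bij g \<and>
    g C1_differentiable_on UNIV \<and> inv g C1_differentiable_on UNIV"

definition positive_twist_map :: "(annulus \<Rightarrow> annulus) \<Rightarrow> bool" where
  "positive_twist_map f \<longleftrightarrow>
    f \<in> Diff1_annulus \<and> (\<exists>\<phi>. isotopy_from_id \<phi> f) \<and>
    (\<forall>F. is_lift F f \<longrightarrow> (\<forall>x. increasing_diffeo (\<lambda>y. fst (F (x, y)))))"

definition oriented_angle :: "real \<times> real \<Rightarrow> real \<times> real \<Rightarrow> circle" where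
  "oriented_angle u w =
    abs_circle (Arg (Complex (fst w) (snd w) / Complex (fst u) (snd u)))"

definition is_angle_lift ::
  "(real \<Rightarrow> annulus \<Rightarrow> annulus) \<Rightarrow> annulus \<Rightarrow> real \<times> real \<Rightarrow> (real \<Rightarrow> real) \<Rightarrow> bool" where
  "is_angle_lift \<phi> z \<xi> v \<longleftrightarrow> continuous_on {0..} v \<and>
    (\<forall>t\<ge>0. abs_circle (v t) =
      oriented_angle (0, 1) (blinfun_apply (annulus_deriv (isotopy_extension \<phi> t) z) \<xi>))"

text \<open>
  Two angle lifts differ by a constant in \<open>2\<pi>\<int>\<close>, so the choice of \<open>v\<close> is immaterial. The value at
  \<open>n = 0\<close> is \<open>0\<close> and does not affect limits.
\<close>

definition torsion_at_time ::
  "(real \<Rightarrow> annulus \<Rightarrow> annulus) \<Rightarrow> annulus \<Rightarrow> real \<times> real \<Rightarrow> nat \<Rightarrow> real" where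
  "torsion_at_time \<phi> z \<xi> n =
    (let v = (SOME v. is_angle_lift \<phi> z \<xi> v) in (v (real n) - v 0) / real n)"

definition torsion_exists :: "(real \<Rightarrow> annulus \<Rightarrow> annulus) \<Rightarrow> annulus \<Rightarrow> bool" where
  "torsion_exists \<phi> z \<longleftrightarrow> (\<exists>\<xi>. \<xi> \<noteq> 0 \<and> convergent (torsion_at_time \<phi> z \<xi>))"

text \<open>The limit is the same for every \<open>\<xi>\<close> for which it exists, hence the definite description.\<close>

definition torsion :: "(real \<Rightarrow> annulus \<Rightarrow> annulus) \<Rightarrow> annulus \<Rightarrow> real" where
  "torsion \<phi> z = (THE \<tau>. \<exists>\<xi>. \<xi> \<noteq> 0 \<and> torsion_at_time \<phi> z \<xi> \<longlonglongrightarrow> \<tau>)"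

end

theory Submission
  imports Defs
begin

text \<open>
  Lift the isotopy to \<open>F\<^sub>t\<close> and fix a point \<open>p\<close>. The chords \<open>F\<^sub>t(p + (0, \<sigma>)) - F\<^sub>t(p)\<close>, divided by \<open>\<sigma>\<close>,
  extend continuously to \<open>\<sigma> = 0\<close>, where they become the images of the vertical vector, and never vanish,
  so they have a continuous angle on \<open>[0, 1] \<times> [0, l]\<close>. For large \<open>\<sigma>\<close> the chord points upwards at all
  times, because the isotopy is proper; at time \<open>1\<close> it points to the right for all \<open>\<sigma> > 0\<close>, because of the
  twist. Hence the vertical vector turns by an angle in \<open>[-\<pi>, 0]\<close> in unit time. Since linear
  isomorphisms keep non-parallel vectors non-parallel, two angles along an orbit never cross modulo \<open>\<pi>\<close>;
  so after \<open>n\<close> units of time every vector has turned by an angle in \<open>[-n\<pi> - \<pi>, \<pi>]\<close>.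
\<close>

section \<open>The circle and lifts\<close>

lemma dist_abs_circle_le: "dist (abs_circle x) (abs_circle y) \<le> \<bar>x - y\<bar>"
  unfolding dist_circle_def by (rule cInf_lower) (auto intro: bdd_belowI[of _ 0])

text \<open>The embedding of the circle as the unit circle of the complex plane. It makes continuous
  complex logarithms available for lifting.\<close>

definition circle_cis :: "circle \<Rightarrow> complex" where
  "circle_cis a = cis (rep_circle a)"

lemma cis_eq_iff: "cis x = cis y \<longleftrightarrow> (\<exists>k::int. x = y + 2 * pi * of_int k)"
  using sin_cos_eq_iff[of x y] by (auto simp: complex_eq_iff)

lemma circle_cis_abs [simp]: "circle_cis (abs_circle x) = cis x"
proof -
  have "abs_circle (rep_circle (abs_circle x)) = abs_circle x"
    using Quotient3_abs_rep[OF Quotient3_circle] by blast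
  then show ?thesis
    unfolding circle_cis_def abs_circle_eq_iff cis_eq_iff .
qed

lemma abs_circle_eq_iff_cis: "abs_circle x = abs_circle y \<longleftrightarrow> cis x = cis y"
  by (simp add: abs_circle_eq_iff cis_eq_iff)

lemma dist_cis_le: "dist (cis x) (cis y) \<le> \<bar>x - y\<bar>"
proof -
  have "norm (cis x - cis y) \<le> 1 * norm (x - y)"
  proof (rule differentiable_bound[where S = UNIV and f' = "\<lambda>x h. h *\<^sub>R (\<i> * cis x)"])
    show "(cis has_derivative (\<lambda>h. h *\<^sub>R (\<i> * cis x))) (at x within UNIV)" for x
      by (auto intro!: derivative_eq_intros)
    show "onorm (\<lambda>h. h *\<^sub>R (\<i> * cis x)) \<le> 1" for x
      by (rule onorm_le) (simp add: norm_mult)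
  qed auto
  then show ?thesis by (simp add: dist_norm)
qed

text \<open>A chord is no longer than its arc, for every choice of representatives; then pass to the
  infimum.\<close>

lemma dist_circle_cis_le: "dist (circle_cis a) (circle_cis b) \<le> dist a b"
  unfolding dist_circle_def[of a b]
proof (rule cInf_greatest)
  show "{\<bar>x - y\<bar> |x y. abs_circle x = a \<and> abs_circle y = b} \<noteq> {}"
    using abs_circle_surj[of a] abs_circle_surj[of b] by auto
  fix r assume "r \<in> {\<bar>x - y\<bar> |x y. abs_circle x = a \<and> abs_circle y = b}"
  then obtain x y where "r = \<bar>x - y\<bar>" "a = abs_circle x" "b = abs_circle y" by auto
  then show "dist (circle_cis a) (circle_cis b) \<le> r"
    using dist_cis_le[of x y] by simp
qed

lemma continuous_on_circle_cis [continuous_intros]: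
  assumes "continuous_on S f"
  shows "continuous_on S (\<lambda>x. circle_cis (f x))"
proof -
  have "continuous_on UNIV circle_cis"
    unfolding continuous_on_iff using dist_circle_cis_le by (meson le_less_trans)
  then show ?thesis
    by (rule continuous_on_compose2[OF _ assms]) auto
qed

lemma continuous_on_abs_circle [continuous_intros]:
  assumes "continuous_on S f"
  shows "continuous_on S (\<lambda>x. abs_circle (f x))"
proof -
  have "continuous_on UNIV abs_circle"
    unfolding continuous_on_iff using dist_abs_circle_le
    by (metis dist_real_def dist_commute le_less_trans)
  then show ?thesis
    by (rule continuous_on_compose2[OF _ assms]) auto
qed

lemma continuous_on_annulus_proj [continuous_intros]:
  "continuous_on S f \<Longrightarrow> continuous_on S (\<lambda>x. annulus_proj (f x))"
  unfolding annulus_proj_def by (intro continuous_intros)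

lemma annulus_proj_eq_iff:
  "annulus_proj p = annulus_proj q \<longleftrightarrow> (\<exists>k::int. p = q + (2 * pi * of_int k, 0))"
  by (auto simp: annulus_proj_def abs_circle_eq_iff prod_eq_iff)

lemma annulus_proj_surj: "\<exists>p. annulus_proj p = z"
  using abs_circle_surj[of "fst z"] by (auto simp: annulus_proj_def prod_eq_iff)

lemma annulus_proj_translate [simp]: "annulus_proj (p + (2 * pi * of_int k, 0)) = annulus_proj p"
  using annulus_proj_eq_iff by blast

lemma snd_annulus_proj [simp]: "snd (annulus_proj p) = snd p"
  by (simp add: annulus_proj_def)

section \<open>Differentials of annulus maps\<close>

lemma eventually_dist_less_isCont:
  assumes "isCont f p" "0 < e"
  shows "\<forall>\<^sub>F q in nhds p. dist (f q) (f p) < e"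
  using assms tendsto_at_iff_tendsto_nhds isCont_def tendstoD by metis

text \<open>The difference of the lifts has values in a lattice of spacing \<open>2 * pi\<close> and
  is continuous at \<open>p\<close>, so near \<open>p\<close> it stays within less than one spacing
  of its value there. Continuity at the single point suffices, as needed for the set-theoretic lifts
  in \<open>has_annulus_derivative\<close>.\<close>

lemma lifts_differ_locally_const:
  assumes F: "\<And>q. annulus_proj (F q) = f (annulus_proj q)" "isCont F p"
    and G: "\<And>q. annulus_proj (G q) = f (annulus_proj q)" "isCont G p"
  shows "\<exists>k::int. \<forall>\<^sub>F q in nhds p. F q = G q + (2 * pi * of_int k, 0)"
proof -
  have "\<exists>k::int. F q = G q + (2 * pi * of_int k, 0)" for q
    using F G annulus_proj_eq_iff by metis
  then obtain k :: "real \<times> real \<Rightarrow> int" where k: "\<And>q. F q = G q + (2 * pi * of_int (k q), 0)"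
    by metis
  have "isCont (\<lambda>q. F q - G q) p"
    using F G by (intro continuous_intros)
  then have "\<forall>\<^sub>F q in nhds p. dist (F q - G q) (F p - G p) < 2 * pi"
    by (rule eventually_dist_less_isCont) auto
  then have "\<forall>\<^sub>F q in nhds p. F q = G q + (2 * pi * of_int (k p), 0)"
  proof eventually_elim
    case (elim q)
    have "F q - G q - (F p - G p) = (2 * pi * of_int (k q - k p), 0)"
      using k[of q] k[of p] by (simp add: prod_eq_iff algebra_simps)
    then have "\<bar>2 * pi * real_of_int (k q - k p)\<bar> < 2 * pi"
      using elim by (simp add: dist_norm norm_Pair)
    then have "\<bar>real_of_int (k q - k p)\<bar> < 1"
      by (simp add: abs_mult)
    then have "k q = k p" by linarith
    then show ?case using k[of q] by simp
  qed
  then show ?thesis by blast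
qed

text \<open>The definition provides a lift at some point of the fibre; a deck translation carries it
  to the prescribed one.\<close>

lemma has_annulus_derivative_lift:
  assumes "has_annulus_derivative f D (annulus_proj p)"
  shows "\<exists>G. (\<forall>q. annulus_proj (G q) = f (annulus_proj q)) \<and> (G has_derivative blinfun_apply D) (at p)"
proof -
  obtain p' G where G: "annulus_proj p' = annulus_proj p" "\<And>q. annulus_proj (G q) = f (annulus_proj q)"
    "(G has_derivative blinfun_apply D) (at p')"
    using assms unfolding has_annulus_derivative_def by blast
  obtain k :: int where k: "p' = p + (2 * pi * of_int k, 0)"
    using G(1) annulus_proj_eq_iff by blast
  have "((\<lambda>q. G (q + (2 * pi * of_int k, 0))) has_derivative blinfun_apply D) (at p)"
  proof (rule has_derivative_compose[where g = G and f' = "\<lambda>h. h", simplified])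
    show "((\<lambda>q. q + (2 * pi * of_int k, 0)) has_derivative (\<lambda>h. h)) (at p)"
      by (auto intro!: derivative_eq_intros)
    show "(G has_derivative blinfun_apply D) (at (p + (2 * pi * of_int k, 0)))"
      using G(3) k by simp
  qed
  then show ?thesis
    using G(2) by (intro exI[of _ "\<lambda>q. G (q + (2 * pi * of_int k, 0))"]) simp
qed

lemma lift_has_derivative:
  assumes "has_annulus_derivative f D (annulus_proj p)"
    and F: "\<And>q. annulus_proj (F q) = f (annulus_proj q)" "isCont F p"
  shows "(F has_derivative blinfun_apply D) (at p)"
proof -
  obtain G where G: "\<And>q. annulus_proj (G q) = f (annulus_proj q)"
    "(G has_derivative blinfun_apply D) (at p)"
    using has_annulus_derivative_lift[OF assms(1)] by blast
  obtain k :: int where k: "\<forall>\<^sub>F q in nhds p. F q = G q + (2 * pi * of_int k, 0)"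
    using lifts_differ_locally_const[OF F G(1) has_derivative_continuous[OF G(2)]] by blast
  then have *: "\<forall>\<^sub>F q in at p. G q + (2 * pi * of_int k, 0) = F q"
    by (auto simp: eventually_at_filter elim: eventually_mono)
  have "((\<lambda>q. G q + (2 * pi * of_int k, 0)) has_derivative blinfun_apply D) (at p)"
    using G(2) by (auto intro!: derivative_eq_intros)
  then show ?thesis
    by (rule has_derivative_transform_eventually[OF _ *]) (use eventually_nhds_x_imp_x[OF k] in auto)
qed

text \<open>Justifies the definite description in \<open>annulus_deriv\<close>.\<close>

lemma has_annulus_derivative_unique:
  assumes "has_annulus_derivative f D z" "has_annulus_derivative f D' z"
  shows "D = D'"
proof -
  obtain p where p: "z = annulus_proj p" using annulus_proj_surj by metis
  obtain G where G: "\<And>q. annulus_proj (G q) = f (annulus_proj q)"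
    "(G has_derivative blinfun_apply D) (at p)"
    using has_annulus_derivative_lift assms(1) p by blast
  have "(G has_derivative blinfun_apply D') (at p)"
    using lift_has_derivative[OF _ G(1) has_derivative_continuous[OF G(2)]] assms(2) p by blast
  then show ?thesis
    using G(2) has_derivative_unique blinfun_apply_inject by blast
qed

lemma annulus_deriv_eqI: "has_annulus_derivative f D z \<Longrightarrow> annulus_deriv f z = D"
  unfolding annulus_deriv_def using has_annulus_derivative_unique by blast

lemma has_annulus_derivative_compose:
  assumes "has_annulus_derivative f D z" "has_annulus_derivative g D' (f z)"
  shows "has_annulus_derivative (g \<circ> f) (D' o\<^sub>L D) z"
proof -
  obtain p where p: "annulus_proj p = z" using annulus_proj_surj by metis
  obtain F where F: "\<And>q. annulus_proj (F q) = f (annulus_proj q)"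
    "(F has_derivative blinfun_apply D) (at p)"
    using has_annulus_derivative_lift assms(1) p by blast
  obtain G where G: "\<And>q. annulus_proj (G q) = g (annulus_proj q)"
    "(G has_derivative blinfun_apply D') (at (F p))"
    using has_annulus_derivative_lift assms(2) p F(1) by metis
  have "((\<lambda>q. G (F q)) has_derivative (\<lambda>h. D' (D h))) (at p)"
    using F(2) G(2) by (rule has_derivative_compose)
  moreover have "blinfun_apply (D' o\<^sub>L D) = (\<lambda>h. D' (D h))"
    by auto
  ultimately show ?thesis
    unfolding has_annulus_derivative_def using p F(1) G(1)
    by (intro exI[of _ p] exI[of _ "\<lambda>q. G (F q)"]) simp
qed

lemma has_annulus_derivative_id: "has_annulus_derivative id id_blinfun z"
proof -
  obtain p where p: "annulus_proj p = z" using annulus_proj_surj by metis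
  then show ?thesis
    unfolding has_annulus_derivative_def
    by (intro exI[of _ p] exI[of _ "\<lambda>q. q"]) (auto simp: id_blinfun.rep_eq)
qed

lemma C1_has_annulus_derivative:
  assumes "C1_annulus_map f"
  shows "has_annulus_derivative f (annulus_deriv f z) z"
  using assms annulus_deriv_eqI unfolding C1_annulus_map_def by metis

lemma C1_continuous_annulus_deriv:
  assumes "C1_annulus_map f"
  shows "continuous_on UNIV (annulus_deriv f)"
proof -
  obtain f' where "\<And>z. has_annulus_derivative f (f' z) z" "continuous_on UNIV f'"
    using assms unfolding C1_annulus_map_def by blast
  moreover from this have "annulus_deriv f = f'"
    using annulus_deriv_eqI by blast
  ultimately show ?thesis by simp
qed

text \<open>Near each point the map is the projection of a lift that is differentiable, hence
  continuous, at that point.\<close>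

lemma C1_continuous_proj:
  assumes "C1_annulus_map f"
  shows "continuous_on UNIV (\<lambda>q. f (annulus_proj q))"
proof -
  have "isCont (\<lambda>q. f (annulus_proj q)) p" for p
  proof -
    obtain F where F: "\<And>q. annulus_proj (F q) = f (annulus_proj q)"
      "(F has_derivative blinfun_apply (annulus_deriv f (annulus_proj p))) (at p)"
      using has_annulus_derivative_lift[OF C1_has_annulus_derivative[OF assms]] by blast
    have "continuous_on UNIV annulus_proj"
      by (intro continuous_intros)
    then have "isCont annulus_proj (F p)"
      using continuous_on_eq_continuous_at[OF open_UNIV] by blast
    then have "isCont (\<lambda>q. annulus_proj (F q)) p"
      by (rule isCont_o2[OF has_derivative_continuous[OF F(2)]])
    then show ?thesis using F(1) by simp
  qed
  then show ?thesis by (simp add: continuous_at_imp_continuous_on)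
qed

text \<open>By the chain rule the differential of \<open>inv f\<close> is a left inverse of that of
  \<open>f\<close>.\<close>

lemma Diff1_annulus_deriv_nonzero:
  assumes "f \<in> Diff1_annulus" "\<xi> \<noteq> 0"
  shows "annulus_deriv f z \<xi> \<noteq> 0"
proof
  assume 0: "annulus_deriv f z \<xi> = 0"
  have f: "C1_annulus_map f" "C1_annulus_map (inv f)" "inv f \<circ> f = id"
    using assms(1) by (auto simp: Diff1_annulus_def bij_is_inj)
  have "has_annulus_derivative (inv f \<circ> f) (annulus_deriv (inv f) (f z) o\<^sub>L annulus_deriv f z) z"
    using f C1_has_annulus_derivative by (intro has_annulus_derivative_compose)
  then have "annulus_deriv (inv f) (f z) o\<^sub>L annulus_deriv f z = id_blinfun"
    using f(3) has_annulus_derivative_id has_annulus_derivative_unique by metis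
  then have "\<xi> = (annulus_deriv (inv f) (f z) o\<^sub>L annulus_deriv f z) \<xi>"
    by simp
  also have "\<dots> = 0" using 0 by simp
  finally show False using assms(2) by simp
qed

section \<open>Isotopies\<close>

text \<open>Turns convergence on compact sets into joint continuity: \<open>f t q\<close> is
  compared with \<open>f s q\<close> uniformly on a closed ball around \<open>p\<close>, and then
  \<open>f s q\<close> with \<open>f s p\<close>.\<close>

lemma continuous_on_Times_locally_uniform:
  fixes f :: "'s::metric_space \<Rightarrow> 'a::heine_borel \<Rightarrow> 'b::metric_space"
  assumes cont: "\<And>t. t \<in> T \<Longrightarrow> continuous_on UNIV (f t)"
    and unif: "\<And>s K e. s \<in> T \<Longrightarrow> compact K \<Longrightarrow> 0 < e \<Longrightarrow>
      \<exists>d>0. \<forall>t\<in>T. dist t s < d \<longrightarrow> (\<forall>p\<in>K. dist (f s p) (f t p) < e)"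
  shows "continuous_on (T \<times> UNIV) (\<lambda>(t, p). f t p)"
  unfolding continuous_on_iff
proof (intro ballI allI impI)
  fix x :: "'s \<times> 'a" and e :: real
  assume "x \<in> T \<times> UNIV" "0 < e"
  then obtain s p where x: "x = (s, p)" "s \<in> T" by auto
  obtain d1 where d1: "d1 > 0" "\<And>t q. t \<in> T \<Longrightarrow> dist t s < d1 \<Longrightarrow> q \<in> cball p 1 \<Longrightarrow>
      dist (f s q) (f t q) < e / 2"
    using unif[OF x(2) compact_cball, of "e / 2" p 1] \<open>0 < e\<close> by auto
  obtain d2 where d2: "d2 > 0" "\<And>q. dist q p < d2 \<Longrightarrow> dist (f s q) (f s p) < e / 2"
    using cont[OF x(2)] \<open>0 < e\<close> unfolding continuous_on_iff by (metis UNIV_I half_gt_zero)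
  show "\<exists>d>0. \<forall>x'\<in>T \<times> UNIV. dist x' x < d \<longrightarrow>
      dist (case x' of (t, p) \<Rightarrow> f t p) (case x of (t, p) \<Rightarrow> f t p) < e"
  proof (intro exI[of _ "Min {d1, d2, 1}"] conjI ballI impI)
    fix x' assume x': "x' \<in> T \<times> UNIV" "dist x' x < Min {d1, d2, 1}"
    obtain t q where tq: "x' = (t, q)" "t \<in> T" using x' by auto
    have "dist t s < d1" "dist q p < d2" "dist q p < 1"
      using x'(2) dist_fst_le[of x' x] dist_snd_le[of x' x] by (auto simp: tq x)
    then have "dist (f s q) (f t q) < e / 2" "dist (f s q) (f s p) < e / 2"
      using d1(2)[OF tq(2), of q] d2(2)[of q] by (simp_all add: dist_commute[of p q])
    then have "dist (f t q) (f s p) < e"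
      by (rule dist_triangle_half_r)
    then show "dist (case x' of (t, p) \<Rightarrow> f t p) (case x of (t, p) \<Rightarrow> f t p) < e"
      by (simp add: tq x)
  qed (use d1 d2 in auto)
qed

lemma no_crossing_gt:
  fixes g :: "real \<Rightarrow> real"
  assumes "continuous_on {a..b} g" "a \<le> b" "\<And>t. t \<in> {a..b} \<Longrightarrow> g t \<noteq> c" "c < g a"
  shows "c < g b"
  using IVT2'[of g b c a] assms by force

lemma no_crossing_lt:
  fixes g :: "real \<Rightarrow> real"
  assumes "continuous_on {a..b} g" "a \<le> b" "\<And>t. t \<in> {a..b} \<Longrightarrow> g t \<noteq> c" "g a < c"
  shows "g b < c"
  using IVT'[of g a c b] assms by force

locale annulus_isotopy =
  fixes \<phi> :: "real \<Rightarrow> annulus \<Rightarrow> annulus"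
  assumes path: "pathin weak_C1_topology \<phi>"
    and start: "\<phi> 0 = id"
begin

lemma Diff1: "t \<in> {0..1} \<Longrightarrow> \<phi> t \<in> Diff1_annulus"
  using path unfolding pathin_def weak_C1_topology_def continuous_map_def by auto

lemma C1: "t \<in> {0..1} \<Longrightarrow> C1_annulus_map (\<phi> t)"
  using Diff1 unfolding Diff1_annulus_def by blast

text \<open>A generating set of the topology centred at \<open>\<phi> s\<close> is an open
  neighbourhood of \<open>\<phi> s\<close>, so its preimage under the path is relatively
  open.\<close>

lemma locally_uniform:
  assumes "s \<in> {0..1}" "compact K" "0 < e"
  shows "\<exists>d>0. \<forall>t\<in>{0..1}. dist t s < d \<longrightarrow> (\<forall>z\<in>K. dist (\<phi> s z) (\<phi> t z) < e \<and>
    norm (annulus_deriv (\<phi> s) z - annulus_deriv (\<phi> t) z) < e)"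
proof -
  define U where "U = {g \<in> Diff1_annulus. \<forall>z\<in>K. dist (\<phi> s z) (g z) < e \<and>
    norm (annulus_deriv (\<phi> s) z - annulus_deriv g z) < e}"
  have "openin weak_C1_topology U"
    unfolding weak_C1_topology_def
    by (rule topology_generated_by_Basis) (use U_def Diff1[OF assms(1)] assms in blast)
  then have "openin (top_of_set {0..1}) {t \<in> {0..1}. \<phi> t \<in> U}"
    using path unfolding pathin_def continuous_map_def by auto
  moreover have "s \<in> {t \<in> {0..1}. \<phi> t \<in> U}"
    using assms Diff1 by (auto simp: U_def)
  ultimately obtain d where "d > 0" "\<And>t. t \<in> {0..1} \<Longrightarrow> dist t s < d \<Longrightarrow> \<phi> t \<in> U"
    unfolding openin_euclidean_subtopology_iff by (smt (verit) mem_Collect_eq)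
  then show ?thesis
    by (auto simp: U_def)
qed

lemma continuous_on_proj: "continuous_on ({0..1} \<times> UNIV) (\<lambda>(t, p). \<phi> t (annulus_proj p))"
proof (rule continuous_on_Times_locally_uniform)
  fix s :: real and K :: "(real \<times> real) set" and e :: real
  assume "s \<in> {0..1}" "compact K" "0 < e"
  moreover have "compact (annulus_proj ` K)"
    using \<open>compact K\<close> by (intro compact_continuous_image continuous_intros)
  ultimately show "\<exists>d>0. \<forall>t\<in>{0..1}. dist t s < d \<longrightarrow>
      (\<forall>p\<in>K. dist (\<phi> s (annulus_proj p)) (\<phi> t (annulus_proj p)) < e)"
    using locally_uniform[of s "annulus_proj ` K" e] by blast
qed (intro C1_continuous_proj C1)

lemma continuous_on_deriv:
  "continuous_on ({0..1} \<times> UNIV) (\<lambda>(t, p). annulus_deriv (\<phi> t) (annulus_proj p))"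
proof (rule continuous_on_Times_locally_uniform)
  fix s :: real and K :: "(real \<times> real) set" and e :: real
  assume "s \<in> {0..1}" "compact K" "0 < e"
  moreover have "compact (annulus_proj ` K)"
    using \<open>compact K\<close> by (intro compact_continuous_image continuous_intros)
  ultimately show "\<exists>d>0. \<forall>t\<in>{0..1}. dist t s < d \<longrightarrow>
      (\<forall>p\<in>K. dist (annulus_deriv (\<phi> s) (annulus_proj p)) (annulus_deriv (\<phi> t) (annulus_proj p)) < e)"
    using locally_uniform[of s "annulus_proj ` K" e] by (simp add: dist_norm) blast
next
  fix t :: real assume "t \<in> {0..1}"
  then show "continuous_on UNIV (\<lambda>p. annulus_deriv (\<phi> t) (annulus_proj p))"
    by (intro continuous_on_compose2[OF C1_continuous_annulus_deriv[OF C1]] continuous_intros) auto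
qed

text \<open>The first coordinate, seen in the complex unit circle, has a continuous logarithm on the
  contractible domain, whose imaginary part is the lifted coordinate. The second coordinate needs no
  lifting.\<close>

lemma ex_continuous_lift:
  obtains F where "continuous_on ({0..1} \<times> UNIV) (\<lambda>(t, p). F t p)"
    "\<And>t p. t \<in> {0..1} \<Longrightarrow> annulus_proj (F t p) = \<phi> t (annulus_proj p)"
proof -
  define S where "S = {0..1::real} \<times> (UNIV :: (real \<times> real) set)"
  define c where "c = (\<lambda>x. circle_cis (fst (\<phi> (fst x) (annulus_proj (snd x)))))"
  have \<phi>: "continuous_on S (\<lambda>x. \<phi> (fst x) (annulus_proj (snd x)))"
    using continuous_on_proj by (simp add: S_def case_prod_beta)
  then have "continuous_on S c"
    unfolding c_def by (intro continuous_intros)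
  moreover have "contractible S"
    unfolding S_def by (intro convex_imp_contractible convex_Times) auto
  ultimately obtain h where h: "continuous_on S h" "\<And>x. x \<in> S \<Longrightarrow> c x = exp (h x)"
    by (rule continuous_logarithm_on_contractible) (auto simp: c_def circle_cis_def)
  define F where "F = (\<lambda>t p. (Im (h (t, p)), snd (\<phi> t (annulus_proj p))))"
  show thesis
  proof
    show "continuous_on ({0..1} \<times> UNIV) (\<lambda>(t, p). F t p)"
      using h(1) \<phi> unfolding F_def case_prod_beta S_def[symmetric] prod.collapse
      by (intro continuous_intros)
    fix t :: real and p assume t: "t \<in> {0..1}"
    obtain a where a: "fst (\<phi> t (annulus_proj p)) = abs_circle a"
      using abs_circle_surj by metis
    have "cis a = exp (h (t, p))"
      using h(2)[of "(t, p)"] t a by (simp add: S_def c_def)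
    also have "\<dots> = of_real (exp (Re (h (t, p)))) * cis (Im (h (t, p)))"
      by (simp add: exp_eq_polar exp_of_real)
    finally have *: "cis a = of_real (exp (Re (h (t, p)))) * cis (Im (h (t, p)))" .
    \<comment> \<open>Comparing moduli removes the real part of the logarithm.\<close>
    then have "norm (cis a) = norm (of_real (exp (Re (h (t, p)))) * cis (Im (h (t, p))))"
      by simp
    then have "exp (Re (h (t, p))) = 1"
      by (simp add: norm_mult)
    then have "abs_circle (Im (h (t, p))) = abs_circle a"
      using * by (simp add: abs_circle_eq_iff_cis)
    then show "annulus_proj (F t p) = \<phi> t (annulus_proj p)"
      using a by (simp add: F_def annulus_proj_def prod_eq_iff)
  qed
qed

text \<open>For \<open>t\<close> close to \<open>s\<close> the preimage of a strip under \<open>\<phi> t\<close> is connected, contains a point near the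
  middle and misses the circles \<open>\<bar>y\<bar> = R\<close>, because the preimage of a larger strip under \<open>\<phi> s\<close> does.\<close>

lemma locally_proper:
  assumes s: "s \<in> {0..1}" and M: "1 \<le> M"
  shows "\<exists>R. \<exists>d>0. \<forall>t\<in>{0..1}. dist t s < d \<longrightarrow> (\<forall>q. R \<le> \<bar>snd q\<bar> \<longrightarrow> M < \<bar>snd (\<phi> t q)\<bar>)"
proof -
  define B where "B = (\<lambda>m. {z :: annulus. \<bar>snd z\<bar> \<le> m})"
  \<comment> \<open>A single fundamental rectangle covers the strip. Being compact and connected, it
    passes both properties on to continuous images of the strip.\<close>
  have B: "B m = annulus_proj ` ({0..2 * pi} \<times> {-m..m})" for m
  proof -
    have "z \<in> annulus_proj ` ({0..2 * pi} \<times> {-m..m})" if "z \<in> B m" for z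
    proof -
      obtain p where p: "annulus_proj p = z" using annulus_proj_surj by metis
      define k where "k = \<lfloor>fst p / (2 * pi)\<rfloor>"
      have "of_int k \<le> fst p / (2 * pi)" "fst p / (2 * pi) \<le> of_int k + 1"
        unfolding k_def by linarith+
      then have "2 * pi * of_int k \<le> fst p" "fst p \<le> 2 * pi * of_int k + 2 * pi"
        by (simp_all add: field_simps)
      then have "p + (2 * pi * of_int (- k), 0) \<in> {0..2 * pi} \<times> {-m..m}"
        using that p by (cases p) (auto simp: B_def annulus_proj_def)
      then show ?thesis
        using annulus_proj_translate[of p "- k"] p by (metis imageI)
    qed
    then show ?thesis by (auto simp: B_def)
  qed
  have compact_B: "compact (B m)" for m
    unfolding B by (intro compact_continuous_image continuous_intros compact_Times) auto
  have inv_image: "continuous_on UNIV (\<lambda>p. inv (\<phi> t) (annulus_proj p))" if "t \<in> {0..1}" for t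
    using Diff1[OF that] by (intro C1_continuous_proj) (auto simp: Diff1_annulus_def)
  have inv_B: "inv (\<phi> t) ` B m = (\<lambda>p. inv (\<phi> t) (annulus_proj p)) ` ({0..2 * pi} \<times> {-m..m})" for t m
    unfolding B by (simp add: image_image)
  have bij: "bij (\<phi> t)" if "t \<in> {0..1}" for t
    using Diff1[OF that] by (auto simp: Diff1_annulus_def)
  have "compact (snd ` inv (\<phi> s) ` B (M + 1))"
    unfolding inv_B
    by (intro compact_continuous_image compact_Times continuous_intros
        continuous_on_subset[OF inv_image[OF s]]) auto
  then obtain R where R: "\<And>y. y \<in> snd ` inv (\<phi> s) ` B (M + 1) \<Longrightarrow> norm y < R"
    using compact_imp_bounded bounded_pos_less by metis
  have outside: "M + 1 < \<bar>snd (\<phi> s q)\<bar>" if "R \<le> \<bar>snd q\<bar>" for q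
  proof (rule ccontr)
    assume "\<not> M + 1 < \<bar>snd (\<phi> s q)\<bar>"
    then have "snd (inv (\<phi> s) (\<phi> s q)) \<in> snd ` inv (\<phi> s) ` B (M + 1)"
      by (auto simp: B_def)
    then show False
      using R[of "snd q"] bij[OF s] that by (simp add: bij_is_inj)
  qed
  obtain d where d: "d > 0" "\<And>t q. t \<in> {0..1} \<Longrightarrow> dist t s < d \<Longrightarrow> q \<in> B R \<Longrightarrow>
      dist (\<phi> s q) (\<phi> t q) < 1"
    using locally_uniform[OF s compact_B[of R], of 1] by auto
  have "M < \<bar>snd (\<phi> t q)\<bar>" if t: "t \<in> {0..1}" "dist t s < d" and q: "R \<le> \<bar>snd q\<bar>" for t q
  proof (rule ccontr)
    assume "\<not> M < \<bar>snd (\<phi> t q)\<bar>"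
    then have q_in: "q \<in> inv (\<phi> t) ` B M"
      using bij[OF t(1)] by (auto simp: B_def bij_is_inj intro!: image_eqI[of _ _ "\<phi> t q"])
    \<comment> \<open>The preimage of a point of height 0. Since \<open>\<phi> s\<close> and
      \<open>\<phi> t\<close> differ by less than 1 there and \<open>1 \<le> M\<close>,
      \<open>\<phi> t\<close> still sends it into the strip.\<close>
    define q0 where "q0 = inv (\<phi> s) (annulus_proj (0, 0))"
    have q0: "\<phi> s q0 = annulus_proj (0, 0)"
      unfolding q0_def using bij[OF s] by (simp add: bij_is_surj surj_f_inv_f)
    then have q0_lt: "\<bar>snd q0\<bar> < R"
      using outside[of q0] M by (auto simp: not_less[symmetric])
    then have "dist (\<phi> s q0) (\<phi> t q0) < 1"
      using d(2)[OF t, of q0] by (simp add: B_def)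
    then have "\<bar>snd (\<phi> t q0)\<bar> < 1"
      using dist_snd_le[of "\<phi> s q0" "\<phi> t q0"] q0 by (simp add: dist_real_def)
    then have q0_in: "q0 \<in> inv (\<phi> t) ` B M"
      using bij[OF t(1)] M by (auto simp: B_def bij_is_inj intro!: image_eqI[of _ _ "\<phi> t q0"])
    define C where "C = (\<lambda>z. \<bar>snd z\<bar>) ` inv (\<phi> t) ` B M"
    have "connected C"
      unfolding C_def inv_B
      by (intro connected_continuous_image continuous_intros convex_connected convex_Times
          continuous_on_subset[OF inv_image[OF t(1)]]) auto
    moreover have "\<bar>snd q0\<bar> \<in> C" "\<bar>snd q\<bar> \<in> C"
      using q_in q0_in by (auto simp: C_def)
    ultimately have "R \<in> C"
      using q0_lt q connectedD_interval[of C "\<bar>snd q0\<bar>" "\<bar>snd q\<bar>" R] by simp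
    then obtain w where w: "\<bar>snd (inv (\<phi> t) w)\<bar> = R" "w \<in> B M"
      by (auto simp: C_def)
    define r where "r = inv (\<phi> t) w"
    have r: "\<phi> t r = w" "\<bar>snd r\<bar> = R"
      using bij[OF t(1)] w by (auto simp: r_def bij_is_surj surj_f_inv_f)
    have "dist (\<phi> s r) (\<phi> t r) < 1"
      using d(2)[OF t, of r] r by (simp add: B_def)
    then have "\<bar>snd (\<phi> s r) - snd (\<phi> t r)\<bar> < 1"
      using dist_snd_le[of "\<phi> s r" "\<phi> t r"] by (simp add: dist_real_def)
    then show False
      using outside[of r] r w(2) by (simp add: B_def)
  qed
  then show ?thesis using d(1) by blast
qed

text \<open>Compactness of the time interval in the form of bisection: on adjacent intervals the
  larger of the two radii serves for both.\<close>

lemma proper: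
  assumes "1 \<le> M"
  shows "\<exists>R. \<forall>t\<in>{0..1}. \<forall>q. R \<le> \<bar>snd q\<bar> \<longrightarrow> M < \<bar>snd (\<phi> t q)\<bar>"
proof -
  define P where "P = (\<lambda>a b. \<exists>R. \<forall>t\<in>{a..b} \<inter> {0..1}. \<forall>q. R \<le> \<bar>snd q\<bar> \<longrightarrow> M < \<bar>snd (\<phi> t q)\<bar>)"
  have "P 0 1"
    using zero_le_one
  proof (induction rule: Bolzano)
    case (trans a b c)
    obtain R1 where R1: "\<forall>t\<in>{a..b} \<inter> {0..1}. \<forall>q. R1 \<le> \<bar>snd q\<bar> \<longrightarrow> M < \<bar>snd (\<phi> t q)\<bar>"
      using trans(1) by (auto simp: P_def)
    obtain R2 where R2: "\<forall>t\<in>{b..c} \<inter> {0..1}. \<forall>q. R2 \<le> \<bar>snd q\<bar> \<longrightarrow> M < \<bar>snd (\<phi> t q)\<bar>"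
      using trans(2) by (auto simp: P_def)
    have "\<forall>t\<in>{a..c} \<inter> {0..1}. \<forall>q. max R1 R2 \<le> \<bar>snd q\<bar> \<longrightarrow> M < \<bar>snd (\<phi> t q)\<bar>"
      using R1 R2 by (metis IntE IntI atLeastAtMost_iff linear max.bounded_iff)
    then show ?case unfolding P_def by blast
  next
    case (local x)
    then have "x \<in> {0..1}" by simp
    from locally_proper[OF this assms] obtain R d where "d > 0"
      "\<forall>t\<in>{0..1}. dist t x < d \<longrightarrow> (\<forall>q. R \<le> \<bar>snd q\<bar> \<longrightarrow> M < \<bar>snd (\<phi> t q)\<bar>)"
      by blast
    then show ?case
      unfolding P_def by (intro exI[of _ d] conjI allI impI exI[of _ R] ballI) (auto simp: dist_real_def)
  qed
  then show ?thesis by (simp add: P_def)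
qed

end

section \<open>Angles of plane vectors\<close>

text \<open>Angles are measured counterclockwise from the upward vertical \<open>(0, 1)\<close>.\<close>

definition has_angle :: "real \<times> real \<Rightarrow> real \<Rightarrow> bool" where
  "has_angle w a \<longleftrightarrow> w = norm w *\<^sub>R (- sin a, cos a)"

lemma has_angle_components:
  "has_angle w a \<longleftrightarrow> fst w = - (norm w * sin a) \<and> snd w = norm w * cos a"
  unfolding has_angle_def prod_eq_iff by simp

text \<open>Dividing by \<open>Complex 0 1\<close> is a clockwise quarter turn, which takes the
  upward vertical to the positive real axis. The zero vector is excluded because
  \<open>has_angle\<close> holds for it with every angle.\<close>

lemma has_angle_iff_oriented_angle:
  assumes "w \<noteq> 0"
  shows "abs_circle a = oriented_angle (0, 1) w \<longleftrightarrow> has_angle w a"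
proof -
  define c where "c = Complex (snd w) (- fst w)"
  have quot: "Complex (fst w) (snd w) / Complex 0 1 = c"
    by (simp add: c_def complex_eq_iff Re_divide Im_divide)
  have norm: "norm c = norm w"
    by (cases w) (simp add: c_def norm_Pair cmod_def add.commute)
  have "c \<noteq> 0"
    using assms norm by (metis norm_eq_zero)
  then have "abs_circle a = oriented_angle (0, 1) w \<longleftrightarrow> cis a = sgn c"
    using quot by (simp add: oriented_angle_def abs_circle_eq_iff_cis cis_Arg)
  also have "\<dots> \<longleftrightarrow> of_real (norm c) * cis a = of_real (norm c) * sgn c"
    using \<open>c \<noteq> 0\<close> by simp
  also have "of_real (norm c) * sgn c = c"
    by (simp add: sgn_eq)
  also have "of_real (norm c) * cis a = c \<longleftrightarrow> has_angle w a"
    unfolding norm has_angle_components by (auto simp: complex_eq_iff c_def)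
  finally show ?thesis .
qed

text \<open>After a clockwise quarter turn the angle is the imaginary part of a continuous
  logarithm, which exists because a convex domain is contractible.\<close>

lemma ex_continuous_angle:
  fixes V :: "'a::real_normed_vector \<Rightarrow> real \<times> real"
  assumes "continuous_on S V" "convex S" "\<And>x. x \<in> S \<Longrightarrow> V x \<noteq> 0"
  obtains \<theta> where "continuous_on S \<theta>" "\<And>x. x \<in> S \<Longrightarrow> has_angle (V x) (\<theta> x)"
proof -
  define c where "c = (\<lambda>x. Complex (snd (V x)) (- fst (V x)))"
  have "c = (\<lambda>x. of_real (snd (V x)) - \<i> * of_real (fst (V x)))"
    by (auto simp: c_def complex_eq_iff)
  then have "continuous_on S c"
    using assms(1) by (auto intro!: continuous_intros)
  moreover have "c x \<noteq> 0" if "x \<in> S" for x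
    using assms(3)[OF that] by (auto simp: c_def complex_eq_iff prod_eq_iff)
  ultimately obtain h where h: "continuous_on S h" "\<And>x. x \<in> S \<Longrightarrow> c x = exp (h x)"
    using continuous_logarithm_on_contractible[OF _ convex_imp_contractible[OF assms(2)]] by metis
  show thesis
  proof
    show "continuous_on S (\<lambda>x. Im (h x))"
      using h(1) by (intro continuous_intros)
    fix x assume x: "x \<in> S"
    have "norm (V x) = norm (c x)"
      by (cases "V x") (simp add: c_def norm_Pair cmod_def add.commute)
    then have "norm (V x) = exp (Re (h x))"
      using h(2)[OF x] by simp
    moreover have "snd (V x) = exp (Re (h x)) * cos (Im (h x))"
      using arg_cong[OF h(2)[OF x], of Re] by (simp add: c_def Re_exp)
    moreover have "fst (V x) = - (exp (Re (h x)) * sin (Im (h x)))"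
      using arg_cong[OF h(2)[OF x], of Im] by (simp add: c_def Im_exp)
    ultimately show "has_angle (V x) (Im (h x))"
      by (simp add: has_angle_components)
  qed
qed

section \<open>Parallel directions and barriers for angles\<close>

text \<open>The determinant of the matrix with columns \<open>v\<close> and
  \<open>w\<close>.\<close>

definition cross :: "real \<times> real \<Rightarrow> real \<times> real \<Rightarrow> real" where
  "cross v w = fst v * snd w - snd v * fst w"

lemma cross_has_angle:
  assumes "has_angle v a" "has_angle w b"
  shows "cross v w = norm v * norm w * sin (b - a)"
proof -
  have v: "fst v = - (norm v * sin a)" "snd v = norm v * cos a"
    and w: "fst w = - (norm w * sin b)" "snd w = norm w * cos b"
    using assms by (simp_all only: has_angle_components)
  show ?thesis
    unfolding cross_def v(1) w(1) v(2) w(2) sin_diff by (simp add: right_diff_distrib ac_simps)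
qed

lemma cross_eq_0_iff_parallel:
  assumes "v \<noteq> 0"
  shows "cross v w = 0 \<longleftrightarrow> (\<exists>c. w = c *\<^sub>R v)"
proof
  assume c: "cross v w = 0"
  show "\<exists>c. w = c *\<^sub>R v"
  proof (cases "fst v = 0")
    case True
    then have "snd v \<noteq> 0" using assms by (auto simp: prod_eq_iff)
    then have "w = (snd w / snd v) *\<^sub>R v"
      using True c by (auto simp: prod_eq_iff cross_def)
    then show ?thesis ..
  next
    case False
    then have "snd w = fst w / fst v * snd v"
      using c by (simp add: cross_def nonzero_eq_divide_eq mult.commute)
    then have "w = (fst w / fst v) *\<^sub>R v"
      using False by (simp add: prod_eq_iff)
    then show ?thesis ..
  qed
qed (auto simp: cross_def)

text \<open>An injective linear map preserves and reflects the relation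
  \<open>w = c *\<^sub>R v\<close>, for each scalar \<open>c\<close>.\<close>

lemma cross_linear_eq_0_iff:
  assumes "linear A" "\<And>x. x \<noteq> 0 \<Longrightarrow> A x \<noteq> 0" "v \<noteq> 0"
  shows "cross (A v) (A w) = 0 \<longleftrightarrow> cross v w = 0"
proof -
  have "A w = c *\<^sub>R A v \<longleftrightarrow> w = c *\<^sub>R v" for c
    using assms(2)[of "w - c *\<^sub>R v"] linear_diff[OF assms(1)] linear_scale[OF assms(1), of c v] by auto
  then show ?thesis
    using assms by (simp add: cross_eq_0_iff_parallel)
qed

text \<open>Distinct integers are at distance at least 1, so the range is discrete.\<close>

lemma continuous_Ints_constant:
  fixes g :: "'a::topological_space \<Rightarrow> real"
  assumes "connected S" "continuous_on S g" "\<And>t. t \<in> S \<Longrightarrow> g t \<in> \<int>" "s \<in> S" "t \<in> S"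
  shows "g s = g t"
proof -
  have "\<exists>e>0. \<forall>y. y \<in> S \<and> g y \<noteq> g x \<longrightarrow> e \<le> norm (g y - g x)" if "x \<in> S" for x
  proof (intro exI[of _ 1] conjI allI impI)
    fix y assume "y \<in> S \<and> g y \<noteq> g x"
    then show "1 \<le> norm (g y - g x)"
      using assms(3)[OF that] assms(3)[of y] Ints_nonzero_abs_ge1[OF Ints_diff, of "g y" "g x"] by simp
  qed auto
  then have "g constant_on S"
    by (intro continuous_discrete_range_constant assms)
  then show ?thesis
    using assms by (auto simp: constant_on_def)
qed

text \<open>Along a path of invertible maps, two directions that are not parallel never become parallel,
  so that the difference of their angles cannot cross a multiple of \<open>\<pi>\<close>.\<close>

lemma angle_difference_ge:
  fixes A :: "real \<Rightarrow> real \<times> real \<Rightarrow> real \<times> real" and m :: int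
  assumes ab: "a \<le> b"
    and A: "\<And>t. t \<in> {a..b} \<Longrightarrow> linear (A t)" "\<And>t x. t \<in> {a..b} \<Longrightarrow> x \<noteq> 0 \<Longrightarrow> A t x \<noteq> 0"
    and nz: "\<xi> \<noteq> 0" "\<eta> \<noteq> 0"
    and u: "continuous_on {a..b} u" "\<And>t. t \<in> {a..b} \<Longrightarrow> has_angle (A t \<xi>) (u t)"
    and v: "continuous_on {a..b} v" "\<And>t. t \<in> {a..b} \<Longrightarrow> has_angle (A t \<eta>) (v t)"
    and start: "of_int m * pi \<le> v a - u a"
  shows "of_int m * pi \<le> v b - u b"
proof -
  define g where "g = (\<lambda>t. v t - u t)"
  have g: "continuous_on {a..b} g"
    unfolding g_def using u v by (intro continuous_intros)
  have cross: "cross \<xi> \<eta> = 0 \<longleftrightarrow> sin (g t) = 0" if "t \<in> {a..b}" for t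
    using cross_has_angle[OF u(2)[OF that] v(2)[OF that]] A(2)[OF that] nz
      cross_linear_eq_0_iff[OF A(1)[OF that] A(2)[OF that] nz(1), of \<eta>] by (simp add: g_def)
  show ?thesis
  proof (cases "cross \<xi> \<eta> = 0")
    case False
    have "g t \<noteq> of_int m * pi" if "t \<in> {a..b}" for t
      using cross[OF that] False by (auto simp: sin_zero_iff_int2)
    moreover from this[of a] have "of_int m * pi < g a"
      using start ab by (simp add: g_def)
    ultimately have "of_int m * pi < g b"
      using no_crossing_gt[OF g ab] by blast
    then show ?thesis by (simp add: g_def)
  next
    \<comment> \<open>Parallel directions stay parallel, so the difference is always a multiple of
      \<open>pi\<close>, hence constant by continuity.\<close>
    case True
    define l where "l = (\<lambda>t. g t / pi)"
    have "l t \<in> \<int>" if t: "t \<in> {a..b}" for t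
    proof -
      obtain i :: int where "g t = of_int i * pi"
        using cross[OF t] True sin_zero_iff_int2 by auto
      then show ?thesis by (simp add: l_def)
    qed
    then have "l a = l b"
      using ab by (intro continuous_Ints_constant[of "{a..b}"]) (auto simp: l_def intro!: continuous_intros g)
    then show ?thesis
      using start by (simp add: l_def g_def field_simps)
  qed
qed

text \<open>Counterclockwise from the upward vertical leads to the left, so vectors pointing to the
  right have negative sine.\<close>

lemma has_angle_right:
  assumes "has_angle w a" "0 < fst w"
  shows "sin a < 0"
proof (rule ccontr)
  assume "\<not> sin a < 0"
  then have "0 \<le> norm w * sin a" by simp
  then show False using assms by (simp add: has_angle_components)
qed

lemma has_angle_up:
  assumes "has_angle w a" "0 < snd w"
  shows "0 < cos a"
proof (rule ccontr)
  assume "\<not> 0 < cos a"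
  then have "norm w * cos a \<le> 0" by (simp add: mult_nonneg_nonpos)
  then show False using assms by (simp add: has_angle_components)
qed

lemma has_angle_vertical:
  assumes "has_angle (0, 1) a"
  shows "a / (2 * pi) \<in> \<int>"
proof -
  have "cos a = 1"
    using assms by (simp add: has_angle_components)
  then obtain n :: int where "a = of_int n * 2 * pi"
    using cos_one_2pi_int by auto
  then show ?thesis by simp
qed

lemma has_angle_diff_2pi:
  assumes "has_angle w a"
  shows "has_angle w (a - 2 * pi * of_int k)"
proof -
  have "cis (a - 2 * pi * of_int k) = cis a"
    unfolding cis_eq_iff by (rule exI[of _ "- k"]) simp
  then have "cos (a - 2 * pi * of_int k) = cos a" "sin (a - 2 * pi * of_int k) = sin a"
    by (simp_all add: complex_eq_iff)
  then show ?thesis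
    using assms by (simp add: has_angle_def)
qed

lemma bounded_over_n_tendsto_0:
  fixes c :: real
  assumes "\<And>n. \<bar>a n\<bar> \<le> c"
  shows "(\<lambda>n. a n / real n) \<longlonglongrightarrow> 0"
proof (rule Lim_null_comparison)
  show "\<forall>\<^sub>F n in sequentially. norm (a n / real n) \<le> c / real n"
    using assms by (intro always_eventually) (auto simp: divide_right_mono)
  show "(\<lambda>n. c / real n) \<longlonglongrightarrow> 0"
    by (rule lim_const_over_n)
qed

section \<open>The rotation of vertical vectors under a twist map\<close>

context annulus_isotopy
begin

lemma annulus_deriv_start: "annulus_deriv (\<phi> 0) z = id_blinfun"
  unfolding start by (rule annulus_deriv_eqI[OF has_annulus_derivative_id])

text \<open>The chord of the image of a vertical segment, divided by the length \<open>\<sigma>\<close> of the segment.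
  Written as an average of derivatives it makes sense, and is continuous, also for \<open>\<sigma> = 0\<close>.\<close>

definition chord :: "real \<times> real \<Rightarrow> real \<times> real \<Rightarrow> real \<times> real" where
  "chord p = (\<lambda>(t, \<sigma>). integral {0..1}
    (\<lambda>r. annulus_deriv (\<phi> t) (annulus_proj (fst p, snd p + r * \<sigma>)) (0, 1)))"

lemma continuous_on_vertical_deriv:
  "continuous_on (({0..1} \<times> UNIV) \<times> UNIV)
    (\<lambda>(x, r). annulus_deriv (\<phi> (fst x)) (annulus_proj (fst p, snd p + r * snd x)) (0, 1))"
proof -
  have "continuous_on (({0..1} \<times> UNIV) \<times> UNIV)
      (\<lambda>y. (fst (fst y), (fst p, snd p + snd y * snd (fst y)))
        :: real \<times> real \<times> real)"
    by (intro continuous_intros)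
  moreover have "(\<lambda>y. (fst (fst y), (fst p, snd p + snd y * snd (fst y)))) ` (({0..1} \<times> UNIV) \<times> UNIV)
      \<subseteq> {0..1} \<times> UNIV"
    by auto
  ultimately have "continuous_on (({0..1} \<times> UNIV) \<times> UNIV)
      (\<lambda>y. annulus_deriv (\<phi> (fst (fst y))) (annulus_proj (fst p, snd p + snd y * snd (fst y))))"
    using continuous_on_compose2[OF continuous_on_deriv] by fastforce
  then show ?thesis
    unfolding case_prod_beta by (intro blinfun.continuous_on continuous_intros)
qed

lemma continuous_on_chord: "continuous_on ({0..1} \<times> UNIV) (chord p)"
  unfolding chord_def case_prod_beta
  by (rule integral_continuous_on_param[where a = "0::real" and b = 1, simplified])
     (rule continuous_on_subset[OF continuous_on_vertical_deriv], auto)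

lemma chord_0: "chord p (t, 0) = annulus_deriv (\<phi> t) (annulus_proj p) (0, 1)"
  by (simp add: chord_def)

lemma chord_start: "chord p (0, \<sigma>) = (0, 1)"
  by (simp add: chord_def annulus_deriv_start)

text \<open>The fundamental theorem of calculus along the image of the vertical segment from
  \<open>p\<close> to \<open>p + (0, \<sigma>)\<close>, parametrised by
  \<open>{0..1}\<close>.\<close>

lemma chord_eq_lift_difference:
  assumes F: "continuous_on ({0..1} \<times> UNIV) (\<lambda>(t, p). F t p)"
    "\<And>t p. t \<in> {0..1} \<Longrightarrow> annulus_proj (F t p) = \<phi> t (annulus_proj p)"
    and t: "t \<in> {0..1}"
  shows "\<sigma> *\<^sub>R chord p (t, \<sigma>) = F t (fst p, snd p + \<sigma>) - F t p"
proof -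
  have "continuous_on UNIV (F t)"
    by (rule continuous_on_compose2[OF F(1), of _ "\<lambda>q. (t, q)", simplified])
       (use t in \<open>auto intro!: continuous_intros\<close>)
  then have D: "(F t has_derivative annulus_deriv (\<phi> t) (annulus_proj q)) (at q)" for q
    using lift_has_derivative[OF C1_has_annulus_derivative[OF C1[OF t]] F(2)[OF t]]
    using continuous_on_eq_continuous_at[OF open_UNIV] by blast
  have "((\<lambda>r. F t (fst p, snd p + r * \<sigma>)) has_vector_derivative
      \<sigma> *\<^sub>R annulus_deriv (\<phi> t) (annulus_proj (fst p, snd p + r * \<sigma>)) (0, 1)) (at r within {0..1})" for r
  proof -
    have "((\<lambda>r. (fst p, snd p + r * \<sigma>)) has_derivative (\<lambda>h. (0, h * \<sigma>))) (at r within {0..1})"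
      by (auto intro!: derivative_eq_intros)
    from has_derivative_compose[OF this D]
    have "((\<lambda>r. F t (fst p, snd p + r * \<sigma>)) has_derivative
      (\<lambda>h. annulus_deriv (\<phi> t) (annulus_proj (fst p, snd p + r * \<sigma>)) (0, h * \<sigma>))) (at r within {0..1})" .
    moreover have "(0 :: real, h * \<sigma>) = h *\<^sub>R \<sigma> *\<^sub>R (0, 1)" for h
      by simp
    ultimately show ?thesis
      unfolding has_vector_derivative_def by (simp only: blinfun.scaleR_right)
  qed
  from integral_unique[OF fundamental_theorem_of_calculus[OF zero_le_one this]]
  show ?thesis
    by (simp add: chord_def)
qed

text \<open>At \<open>\<sigma> = 0\<close> this is invertibility of the differential. Otherwise a
  zero chord would force the injective map \<open>\<phi> t\<close> to identify two points of
  different heights.\<close>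

lemma chord_nonzero:
  assumes t: "t \<in> {0..1}"
  shows "chord p (t, \<sigma>) \<noteq> 0"
proof (cases "\<sigma> = 0")
  case True
  then show ?thesis
    using Diff1_annulus_deriv_nonzero[OF Diff1[OF t], of "(0, 1)"] by (simp add: chord_0 zero_prod_def)
next
  case False
  obtain F where F: "continuous_on ({0..1} \<times> UNIV) (\<lambda>(t, p). F t p)"
    "\<And>t p. t \<in> {0..1} \<Longrightarrow> annulus_proj (F t p) = \<phi> t (annulus_proj p)"
    using ex_continuous_lift by blast
  show ?thesis
  proof
    assume "chord p (t, \<sigma>) = 0"
    then have "F t (fst p, snd p + \<sigma>) = F t p"
      using chord_eq_lift_difference[OF F t, of \<sigma> p] by simp
    then have "\<phi> t (annulus_proj (fst p, snd p + \<sigma>)) = \<phi> t (annulus_proj p)"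
      using F(2)[OF t] by metis
    then have "annulus_proj (fst p, snd p + \<sigma>) = annulus_proj p"
      using Diff1[OF t] by (auto simp: Diff1_annulus_def dest: bij_is_inj injD)
    then have "snd (annulus_proj (fst p, snd p + \<sigma>)) = snd (annulus_proj p)"
      by simp
    then show False using False by simp
  qed
qed

text \<open>The lower end of the segment keeps its height at most \<open>M\<close> at all times. The
  upper end starts above \<open>M\<close> and beyond the radius given by \<open>proper\<close>, so
  its height never equals \<open>M\<close> and stays above it.\<close>

lemma ex_chord_up: "\<exists>\<sigma>>0. \<forall>t\<in>{0..1}. 0 < snd (chord p (t, \<sigma>))"
proof -
  obtain F where F: "continuous_on ({0..1} \<times> UNIV) (\<lambda>(t, p). F t p)"
    "\<And>t p. t \<in> {0..1} \<Longrightarrow> annulus_proj (F t p) = \<phi> t (annulus_proj p)"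
    using ex_continuous_lift by blast
  have snd_F: "snd (F t q) = snd (\<phi> t (annulus_proj q))" if "t \<in> {0..1}" for t q
    using arg_cong[OF F(2)[OF that, of q], of snd] by simp
  have cont: "continuous_on {0..1} (\<lambda>t. snd (F t q))" for q
    by (intro continuous_on_snd continuous_on_compose2[OF F(1), of _ "\<lambda>t. (t, q)", simplified])
       (auto intro!: continuous_intros)
  have "compact ((\<lambda>t. snd (F t p)) ` {0..1})"
    by (rule compact_continuous_image[OF cont]) simp
  then obtain M0 where M0: "\<And>y. y \<in> (\<lambda>t. snd (F t p)) ` {0..1} \<Longrightarrow> norm y \<le> M0"
    using compact_imp_bounded bounded_iff by metis
  define M where "M = max 1 M0"
  obtain R where R: "\<And>t q. t \<in> {0..1} \<Longrightarrow> R \<le> \<bar>snd q\<bar> \<Longrightarrow> M < \<bar>snd (\<phi> t q)\<bar>"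
    using proper[of M] unfolding M_def by (metis max.cobounded1)
  \<comment> \<open>Puts the upper end beyond \<open>R\<close> and above \<open>M\<close>; the outer
    maximum makes the length positive.\<close>
  define \<sigma> where "\<sigma> = max 1 (max R (M + 1) - snd p)"
  have \<sigma>: "\<sigma> > 0" "R \<le> snd p + \<sigma>" "M < snd p + \<sigma>" "0 \<le> M"
    by (auto simp: \<sigma>_def M_def)
  have "0 < snd (chord p (t, \<sigma>))" if t: "t \<in> {0..1}" for t
  proof -
    define g where "g = (\<lambda>s. snd (F s (fst p, snd p + \<sigma>)))"
    have "g s \<noteq> M" if "s \<in> {0..t}" for s
      using R[of s "annulus_proj (fst p, snd p + \<sigma>)"] snd_F[of s] that t \<sigma> by (auto simp: g_def)
    moreover have "M < g 0"
      using snd_F[of 0] \<sigma> by (simp add: g_def start)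
    ultimately have "M < g t"
      using t by (intro no_crossing_gt[of 0 t g M])
        (auto simp: g_def intro: continuous_on_subset[OF cont])
    moreover have "snd (F t p) \<le> M"
      using M0[of "snd (F t p)"] t by (auto simp: M_def)
    ultimately have "0 < \<sigma> * snd (chord p (t, \<sigma>))"
      using arg_cong[OF chord_eq_lift_difference[OF F t, of \<sigma> p], of snd] by (simp add: g_def)
    then show ?thesis
      using \<sigma>(1) by (simp add: zero_less_mult_iff)
  qed
  then show ?thesis using \<sigma>(1) by blast
qed

lemma chord_right:
  assumes twist: "\<forall>F x. is_lift F (\<phi> 1) \<longrightarrow> strict_mono (\<lambda>y. fst (F (x, y)))" and "0 < \<sigma>"
  shows "0 < fst (chord p (1, \<sigma>))"
proof -
  obtain F where F: "continuous_on ({0..1} \<times> UNIV) (\<lambda>(t, p). F t p)"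
    "\<And>t p. t \<in> {0..1} \<Longrightarrow> annulus_proj (F t p) = \<phi> t (annulus_proj p)"
    using ex_continuous_lift by blast
  have "continuous_on UNIV (F 1)"
    by (rule continuous_on_compose2[OF F(1), of _ "\<lambda>q. (1, q)", simplified])
       (auto intro!: continuous_intros)
  then have "is_lift (F 1) (\<phi> 1)"
    using F(2) by (simp add: is_lift_def)
  from strict_monoD[OF twist[rule_format, OF this], of "snd p" "snd p + \<sigma>" "fst p"]
  have "0 < \<sigma> * fst (chord p (1, \<sigma>))"
    using assms(2) arg_cong[OF chord_eq_lift_difference[OF F, of 1 \<sigma> p], of fst] by simp
  then show ?thesis
    using assms(2) by (simp add: zero_less_mult_iff)
qed

text \<open>The angle at \<open>(1, 0)\<close> is controlled by going around the other three sides
  of the rectangle: up the side \<open>t = 0\<close>, along the side \<open>\<sigma> = l\<close>,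
  and down the side \<open>t = 1\<close>.\<close>

lemma ex_vertical_angle:
  assumes twist: "\<forall>F x. is_lift F (\<phi> 1) \<longrightarrow> strict_mono (\<lambda>y. fst (F (x, y)))"
  obtains v where "continuous_on {0..1} v"
    "\<And>t. t \<in> {0..1} \<Longrightarrow> has_angle (annulus_deriv (\<phi> t) z (0, 1)) (v t)"
    "v 0 = 0" "v 1 \<in> {- pi..0}"
proof -
  obtain p where p: "annulus_proj p = z" using annulus_proj_surj by metis
  obtain l where l: "l > 0" "\<And>t. t \<in> {0..1} \<Longrightarrow> 0 < snd (chord p (t, l))"
    using ex_chord_up by metis
  define S where "S = {0..1::real} \<times> {0..l}"
  have "continuous_on S (chord p)"
    by (rule continuous_on_subset[OF continuous_on_chord]) (auto simp: S_def)
  moreover have "convex S"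
    unfolding S_def by (intro convex_Times) auto
  moreover have "chord p x \<noteq> 0" if "x \<in> S" for x
    using that chord_nonzero[of "fst x" p "snd x"] by (auto simp: S_def)
  ultimately obtain \<theta>0 where \<theta>0: "continuous_on S \<theta>0" "\<And>x. x \<in> S \<Longrightarrow> has_angle (chord p x) (\<theta>0 x)"
    by (metis ex_continuous_angle)
  \<comment> \<open>At time 0 the chord is the vertical vector, so subtracting a multiple of
    \<open>2 * pi\<close> normalises the angle to 0.\<close>
  have "\<theta>0 (0, 0) / (2 * pi) \<in> \<int>"
    using has_angle_vertical \<theta>0(2)[of "(0, 0)"] l by (simp add: S_def chord_start)
  then obtain k :: int where k: "\<theta>0 (0, 0) / (2 * pi) = of_int k"
    by (auto elim: Ints_cases)
  define \<theta> where "\<theta> = (\<lambda>x. \<theta>0 x - 2 * pi * of_int k)"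
  have \<theta>: "continuous_on S \<theta>" "\<And>x. x \<in> S \<Longrightarrow> has_angle (chord p x) (\<theta> x)" "\<theta> (0, 0) = 0"
    using \<theta>0 k has_angle_diff_2pi by (auto simp: \<theta>_def field_simps intro!: continuous_intros)
  have horizontal: "continuous_on {0..1} (\<lambda>t. \<theta> (t, \<sigma>))" if "\<sigma> \<in> {0..l}" for \<sigma>
    by (rule continuous_on_compose2[OF \<theta>(1)]) (use that in \<open>auto simp: S_def intro!: continuous_intros\<close>)
  have vertical: "continuous_on {0..l} (\<lambda>\<sigma>. \<theta> (t, \<sigma>))" if "t \<in> {0..1}" for t
    by (rule continuous_on_compose2[OF \<theta>(1)]) (use that in \<open>auto simp: S_def intro!: continuous_intros\<close>)
  \<comment> \<open>First side: the chord remains vertical, so the angle cannot leave 0.\<close>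
  have "\<theta> (0, 0) / (2 * pi) = \<theta> (0, l) / (2 * pi)"
  proof (rule continuous_Ints_constant[of "{0..l}" "\<lambda>\<sigma>. \<theta> (0, \<sigma>) / (2 * pi)"])
    show "\<theta> (0, \<sigma>) / (2 * pi) \<in> \<int>" if "\<sigma> \<in> {0..l}" for \<sigma>
      using has_angle_vertical \<theta>(2)[of "(0, \<sigma>)"] that by (simp add: S_def chord_start)
  qed (use l vertical[of 0] in \<open>auto intro!: continuous_intros\<close>)
  then have \<theta>0l: "\<theta> (0, l) = 0"
    using \<theta>(3) by simp
  \<comment> \<open>Second side: the chord points upwards, which confines the angle between the two
    right angles.\<close>
  have avoid: "\<theta> (t, l) \<noteq> pi / 2" "\<theta> (t, l) \<noteq> - (pi / 2)" if "t \<in> {0..1}" for t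
  proof -
    have "0 < cos (\<theta> (t, l))"
      using has_angle_up[OF \<theta>(2) l(2)[OF that]] that l by (simp add: S_def)
    then show "\<theta> (t, l) \<noteq> pi / 2" "\<theta> (t, l) \<noteq> - (pi / 2)"
      by (metis cos_minus cos_pi_half order_less_irrefl)+
  qed
  have "\<theta> (1, l) < pi / 2" "- (pi / 2) < \<theta> (1, l)"
    using no_crossing_lt[OF horizontal[of l] zero_le_one avoid(1)] l
      no_crossing_gt[OF horizontal[of l] zero_le_one avoid(2)] \<theta>0l by auto
  \<comment> \<open>Third side: by the twist the sine is negative, so the angle avoids both 0 and
    \<open>- pi\<close>.\<close>
  moreover have neg: "sin (\<theta> (1, \<sigma>)) < 0" if "\<sigma> \<in> {0<..l}" for \<sigma>
    using has_angle_right[OF \<theta>(2) chord_right[OF twist], of \<sigma>] that by (auto simp: S_def)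
  ultimately have corner: "\<theta> (1, l) < 0" "- pi < \<theta> (1, l)"
    using neg[of l] l sin_ge_zero[of "\<theta> (1, l)"] by (auto simp: not_le[symmetric])
  have range: "\<theta> (1, \<sigma>) \<in> {- pi..0}" if \<sigma>: "\<sigma> \<in> {0<..l}" for \<sigma>
  proof (rule ccontr)
    assume not: "\<theta> (1, \<sigma>) \<notin> {- pi..0}"
    have cont: "continuous_on {\<sigma>..l} (\<lambda>\<sigma>. \<theta> (1, \<sigma>))"
      by (rule continuous_on_subset[OF vertical]) (use \<sigma> in auto)
    have avoid: "\<theta> (1, \<tau>) \<noteq> 0" "\<theta> (1, \<tau>) \<noteq> - pi" if "\<tau> \<in> {\<sigma>..l}" for \<tau>
      using neg[of \<tau>] that \<sigma> by auto
    show False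
      using no_crossing_gt[OF cont _ avoid(1)] no_crossing_lt[OF cont _ avoid(2)] corner not \<sigma> by fastforce
  qed
  \<comment> \<open>At \<open>\<sigma> = 0\<close> the twist gives no strict inequality; the closed
    bounds pass to the limit.\<close>
  have "\<theta> (1, 0) \<in> {- pi..0}"
  proof -
    have "continuous_on (closure {0<..<l}) (\<lambda>\<sigma>. \<theta> (1, \<sigma>))"
      using vertical[of 1] l by simp
    moreover have "0 \<in> closure {0<..<l}"
      using l by simp
    moreover have "(\<lambda>\<sigma>. \<theta> (1, \<sigma>)) ` {0<..<l} \<subseteq> {- pi..0}"
      using range by (intro image_subsetI) simp
    ultimately show ?thesis
      using image_closure_subset[of "{0<..<l}" "\<lambda>\<sigma>. \<theta> (1, \<sigma>)" "{- pi..0}"] by blast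
  qed
  then show thesis
  proof (intro that[of "\<lambda>t. \<theta> (t, 0)"])
    show "has_angle (annulus_deriv (\<phi> t) z (0, 1)) (\<theta> (t, 0))" if "t \<in> {0..1}" for t
      using \<theta>(2)[of "(t, 0)"] that l by (simp add: S_def chord_0 p)
  qed (use \<theta>(3) l horizontal in auto)
qed

section \<open>Angles along the iterates\<close>

text \<open>The formula includes the right endpoint, where \<open>\<phi> 1\<close> after
  \<open>n\<close> iterates agrees with \<open>\<phi> 0 = id\<close> after \<open>n + 1\<close>.
  This makes consecutive pieces match at integer times.\<close>

lemma isotopy_extension_eq:
  assumes "real n \<le> t" "t \<le> real n + 1"
  shows "isotopy_extension \<phi> t = \<phi> (t - real n) \<circ> (\<phi> 1 ^^ n)"
proof (cases "t = real n + 1")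
  case True
  then have "\<lfloor>t\<rfloor> = int (Suc n)" "frac t = 0"
    by (simp_all add: frac_def)
  then have "nat \<lfloor>t\<rfloor> = Suc n" by simp
  then show ?thesis
    unfolding isotopy_extension_def \<open>frac t = 0\<close> using True by (simp add: start)
next
  case False
  then have "\<lfloor>t\<rfloor> = int n"
    using assms by (intro floor_unique) auto
  then show ?thesis
    by (simp add: isotopy_extension_def frac_def)
qed

lemma iterate_deriv_Suc:
  assumes "has_annulus_derivative (\<phi> 1 ^^ n) D z"
  shows "has_annulus_derivative (\<phi> 1 ^^ Suc n) (annulus_deriv (\<phi> 1) ((\<phi> 1 ^^ n) z) o\<^sub>L D) z"
  unfolding funpow.simps
  by (intro has_annulus_derivative_compose assms C1_has_annulus_derivative C1) simp

lemma has_iterate_deriv: "has_annulus_derivative (\<phi> 1 ^^ n) (annulus_deriv (\<phi> 1 ^^ n) z) z"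
proof (induction n)
  case 0
  then show ?case
    unfolding funpow.simps annulus_deriv_eqI[OF has_annulus_derivative_id]
    by (rule has_annulus_derivative_id)
next
  case (Suc n)
  show ?case
    using iterate_deriv_Suc[OF Suc] annulus_deriv_eqI by metis
qed

lemma iterate_deriv_nonzero: "\<xi> \<noteq> 0 \<Longrightarrow> annulus_deriv (\<phi> 1 ^^ n) z \<xi> \<noteq> 0"
proof (induction n)
  case 0
  then show ?case
    unfolding funpow.simps annulus_deriv_eqI[OF has_annulus_derivative_id] by simp
next
  case (Suc n)
  then show ?case
    unfolding annulus_deriv_eqI[OF iterate_deriv_Suc[OF has_iterate_deriv]] blinfun_apply_blinfun_compose
    by (intro Diff1_annulus_deriv_nonzero[OF Diff1]) auto
qed

lemma extension_deriv:
  assumes "real n \<le> t" "t \<le> real n + 1"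
  shows "annulus_deriv (isotopy_extension \<phi> t) z =
    annulus_deriv (\<phi> (t - real n)) ((\<phi> 1 ^^ n) z) o\<^sub>L annulus_deriv (\<phi> 1 ^^ n) z"
  unfolding isotopy_extension_eq[OF assms]
  by (intro annulus_deriv_eqI has_annulus_derivative_compose C1_has_annulus_derivative C1
      has_iterate_deriv) (use assms in auto)

lemma extension_deriv_nonzero:
  assumes "0 \<le> t" "\<xi> \<noteq> 0"
  shows "annulus_deriv (isotopy_extension \<phi> t) z \<xi> \<noteq> 0"
proof -
  define n where "n = nat \<lfloor>t\<rfloor>"
  have n: "real n \<le> t" "t \<le> real n + 1"
    using assms(1) unfolding n_def by linarith+
  then show ?thesis
    unfolding extension_deriv[OF n] blinfun_apply_blinfun_compose
    by (intro Diff1_annulus_deriv_nonzero Diff1 iterate_deriv_nonzero assms(2)) auto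
qed

text \<open>The chain rule gives continuity on each closed unit interval. Finitely many pieces are
  glued at a time, and continuity at \<open>t\<close> only concerns an initial interval reaching
  beyond \<open>t\<close>.\<close>

lemma continuous_on_extension_deriv:
  "continuous_on {0..} (\<lambda>t. annulus_deriv (isotopy_extension \<phi> t) z)" (is "continuous_on _ ?D")
proof -
  have piece: "continuous_on {real n..real n + 1} ?D" for n
  proof -
    obtain p where p: "annulus_proj p = (\<phi> 1 ^^ n) z" using annulus_proj_surj by metis
    have "continuous_on {real n..real n + 1}
        (\<lambda>t. (\<lambda>(t, p). annulus_deriv (\<phi> t) (annulus_proj p)) (t - real n, p))"
      by (rule continuous_on_compose2[OF continuous_on_deriv]) (auto intro!: continuous_intros)
    then have "continuous_on {real n..real n + 1}
        (\<lambda>t. annulus_deriv (\<phi> (t - real n)) ((\<phi> 1 ^^ n) z) o\<^sub>L annulus_deriv (\<phi> 1 ^^ n) z)"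
      unfolding p[symmetric] prod.case
      by (intro bounded_bilinear.continuous_on[OF bounded_bilinear_blinfun_compose] continuous_intros)
    then show ?thesis
      by (rule continuous_on_eq) (auto simp: extension_deriv)
  qed
  have initial: "continuous_on {0..real n} ?D" for n
  proof (induction n)
    case (Suc n)
    have "continuous_on ({0..real n} \<union> {real n..real n + 1}) ?D"
      by (rule continuous_on_closed_Un[OF _ _ Suc piece]) auto
    moreover have "{0..real n} \<union> {real n..real n + 1} = {0..real (Suc n)}"
      by auto
    ultimately show ?case by simp
  qed simp
  show ?thesis
    unfolding continuous_on_eq_continuous_within
  proof
    fix t :: real assume t: "t \<in> {0..}"
    obtain n where n: "t < real n"
      using reals_Archimedean2 by blast
    have "at t within {0..} = at t within {0..real n}"
      by (rule at_within_nhd[of t "{..<real n}"]) (use n in auto)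
    then show "continuous (at t within {0..}) ?D"
      using initial[of n] t n by (simp add: continuous_on_eq_continuous_within)
  qed
qed

section \<open>Angle lifts along an orbit\<close>

lemma is_angle_lift_iff:
  assumes "\<xi> \<noteq> 0"
  shows "is_angle_lift \<phi> z \<xi> v \<longleftrightarrow> continuous_on {0..} v \<and>
    (\<forall>t\<ge>0. has_angle (annulus_deriv (isotopy_extension \<phi> t) z \<xi>) (v t))"
  unfolding is_angle_lift_def
  using has_angle_iff_oriented_angle[OF extension_deriv_nonzero[OF _ assms]] by auto

lemma ex_angle_lift:
  assumes "\<xi> \<noteq> 0"
  shows "\<exists>v. is_angle_lift \<phi> z \<xi> v"
proof -
  have "continuous_on {0..} (\<lambda>t. annulus_deriv (isotopy_extension \<phi> t) z \<xi>)"
    by (intro blinfun.continuous_on continuous_on_extension_deriv continuous_intros)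
  moreover have "convex {0::real..}"
    by (rule convex_real_interval)
  ultimately obtain v where "continuous_on {0..} v"
    "\<And>t. t \<in> {0..} \<Longrightarrow> has_angle (annulus_deriv (isotopy_extension \<phi> t) z \<xi>) (v t)"
    by (rule ex_continuous_angle) (use extension_deriv_nonzero assms in auto)
  then show ?thesis
    using is_angle_lift_iff[OF assms] by auto
qed

lemma torsion_at_time_eq:
  assumes "\<xi> \<noteq> 0"
  obtains v where "is_angle_lift \<phi> z \<xi> v"
    "\<And>n. torsion_at_time \<phi> z \<xi> n = (v (real n) - v 0) / real n"
  using someI_ex[OF ex_angle_lift[OF assms]] unfolding torsion_at_time_def Let_def by blast

text \<open>The largest multiple of \<open>pi\<close> not above the initial difference is a barrier;
  rounding down costs at most \<open>pi\<close>. Exchanging the vectors gives the opposite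
  bound.\<close>

lemma angle_lifts_bounded_difference:
  assumes "\<xi> \<noteq> 0" "\<eta> \<noteq> 0" "is_angle_lift \<phi> z \<xi> u" "is_angle_lift \<phi> z \<eta> v"
  shows "v 0 - u 0 - pi \<le> v (real n) - u (real n)"
proof -
  define m where "m = \<lfloor>(v 0 - u 0) / pi\<rfloor>"
  have "of_int m \<le> (v 0 - u 0) / pi" "(v 0 - u 0) / pi - 1 \<le> of_int m"
    unfolding m_def by linarith+
  then have m: "of_int m * pi \<le> v 0 - u 0" "v 0 - u 0 - pi \<le> of_int m * pi"
    by (simp_all add: field_simps)
  have u: "continuous_on {0..} u" "\<And>t. 0 \<le> t \<Longrightarrow> has_angle (annulus_deriv (isotopy_extension \<phi> t) z \<xi>) (u t)"
    and v: "continuous_on {0..} v" "\<And>t. 0 \<le> t \<Longrightarrow> has_angle (annulus_deriv (isotopy_extension \<phi> t) z \<eta>) (v t)"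
    using assms is_angle_lift_iff by auto
  have "of_int m * pi \<le> v (real n) - u (real n)"
  proof (rule angle_difference_ge[OF _ _ _ assms(1,2), where a = 0 and b = "real n" and u = u and v = v and
        A = "\<lambda>t. annulus_deriv (isotopy_extension \<phi> t) z"])
    show "linear (annulus_deriv (isotopy_extension \<phi> t) z)" for t
      by (intro bounded_linear.linear blinfun.bounded_linear_right)
    show "continuous_on {0..real n} u" "continuous_on {0..real n} v"
      using u(1) v(1) by (auto elim: continuous_on_subset)
  qed (use u(2) v(2) m extension_deriv_nonzero in auto)
  then show ?thesis using m by linarith
qed

text \<open>The half-turns of the vertical direction are barriers for the angles of all other directions.\<close>

lemma angle_lift_step:
  fixes m :: int
  assumes twist: "\<forall>F x. is_lift F (\<phi> 1) \<longrightarrow> strict_mono (\<lambda>y. fst (F (x, y)))"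
    and \<xi>: "\<xi> \<noteq> 0" and v: "is_angle_lift \<phi> z \<xi> v"
  shows "v (real n) \<le> of_int m * pi \<Longrightarrow> v (real (Suc n)) \<le> of_int m * pi"
    and "of_int m * pi \<le> v (real n) \<Longrightarrow> of_int m * pi - pi \<le> v (real (Suc n))"
proof -
  define w where "w = (\<phi> 1 ^^ n) z"
  define \<eta> where "\<eta> = annulus_deriv (\<phi> 1 ^^ n) z \<xi>"
  \<comment> \<open>The vertical vector is taken anew at the point \<open>w\<close>, not transported
    from \<open>z\<close>, so its angle starts at 0 in every step.\<close>
  obtain v0 where v0: "continuous_on {0..1} v0"
    "\<And>t. t \<in> {0..1} \<Longrightarrow> has_angle (annulus_deriv (\<phi> t) w (0, 1)) (v0 t)"
    "v0 0 = 0" "v0 1 \<in> {- pi..0}"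
    using ex_vertical_angle[OF twist] by blast
  define u where "u = (\<lambda>s. v (real n + s))"
  have v': "continuous_on {0..} v"
    "\<And>t. 0 \<le> t \<Longrightarrow> has_angle (annulus_deriv (isotopy_extension \<phi> t) z \<xi>) (v t)"
    using v is_angle_lift_iff[OF \<xi>] by auto
  have u: "continuous_on {0..1} u"
    unfolding u_def by (rule continuous_on_compose2[OF v'(1)]) (auto intro!: continuous_intros)
  have u_angle: "has_angle (annulus_deriv (\<phi> s) w \<eta>) (u s)" if "s \<in> {0..1}" for s
    using v'(2)[of "real n + s"] extension_deriv[of n "real n + s" z] that
    by (simp add: u_def w_def \<eta>_def)
  have \<eta>: "\<eta> \<noteq> 0"
    using iterate_deriv_nonzero[OF \<xi>] by (simp add: \<eta>_def)
  have vert: "(0, 1) \<noteq> (0 :: real \<times> real)"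
    by (simp add: zero_prod_def)
  have A: "linear (annulus_deriv (\<phi> t) w)" "x \<noteq> 0 \<Longrightarrow> annulus_deriv (\<phi> t) w x \<noteq> 0"
    if "t \<in> {0..1}" for t x
    using that Diff1_annulus_deriv_nonzero Diff1
    by (auto intro: blinfun.bounded_linear_right[THEN bounded_linear.linear])
  have u_ends: "u 0 = v (real n)" "u 1 = v (real (Suc n))"
    by (simp_all add: u_def add.commute)
  show "v (real (Suc n)) \<le> of_int m * pi" if "v (real n) \<le> of_int m * pi"
    \<comment> \<open>Here \<open>v0 - u\<close> is bounded below by \<open>- m * pi\<close>, and
      \<open>v0\<close> ends at or below 0.\<close>
    using angle_difference_ge[OF zero_le_one A \<eta> vert u u_angle v0(1,2), of "- m"] that v0 u_ends by simp
  show "of_int m * pi - pi \<le> v (real (Suc n))" if "of_int m * pi \<le> v (real n)"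
    using angle_difference_ge[OF zero_le_one A vert \<eta> v0(1,2) u u_angle, of m] that v0 u_ends by simp
qed

text \<open>The initial angle lies between consecutive multiples of \<open>pi\<close>. The upper one
  remains a barrier, the lower one drops by \<open>pi\<close> at each step, and the rounding
  accounts for the extra \<open>pi\<close>.\<close>

lemma angle_lift_bounds:
  assumes twist: "\<forall>F x. is_lift F (\<phi> 1) \<longrightarrow> strict_mono (\<lambda>y. fst (F (x, y)))"
    and \<xi>: "\<xi> \<noteq> 0" and v: "is_angle_lift \<phi> z \<xi> v"
  shows "v (real n) - v 0 \<le> pi" "- (real n * pi) - pi \<le> v (real n) - v 0"
proof -
  define m where "m = \<lfloor>v 0 / pi\<rfloor>"
  have "of_int m \<le> v 0 / pi" "v 0 / pi \<le> of_int m + 1"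
    unfolding m_def by linarith+
  then have m: "of_int m * pi \<le> v 0" "v 0 \<le> of_int (m + 1) * pi"
    by (simp_all add: field_simps)
  have "v (real n) \<le> of_int (m + 1) * pi"
  proof (induction n)
    case (Suc n)
    then show ?case by (rule angle_lift_step(1)[OF twist \<xi> v])
  qed (use m in simp)
  then show "v (real n) - v 0 \<le> pi"
    using m by (simp add: algebra_simps)
  have "of_int (m - int n) * pi \<le> v (real n)"
  proof (induction n)
    case (Suc n)
    from angle_lift_step(2)[OF twist \<xi> v this] show ?case by (simp add: algebra_simps)
  qed (use m in simp)
  then show "- (real n * pi) - pi \<le> v (real n) - v 0"
    using m by (simp add: algebra_simps)
qed

section \<open>Limits of the finite-time torsion\<close>

text \<open>Justifies the definite description in \<open>torsion\<close>: the total rotations of two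
  vectors differ by at most \<open>pi\<close>, which vanishes after division by
  \<open>n\<close>.\<close>

lemma torsion_limit_unique:
  assumes "\<xi> \<noteq> 0" "torsion_at_time \<phi> z \<xi> \<longlonglongrightarrow> \<sigma>"
    and "\<eta> \<noteq> 0" "torsion_at_time \<phi> z \<eta> \<longlonglongrightarrow> \<tau>"
  shows "\<sigma> = \<tau>"
proof -
  obtain u where u: "is_angle_lift \<phi> z \<xi> u"
    "\<And>n. torsion_at_time \<phi> z \<xi> n = (u (real n) - u 0) / real n"
    using torsion_at_time_eq[OF assms(1)] by blast
  obtain v where v: "is_angle_lift \<phi> z \<eta> v"
    "\<And>n. torsion_at_time \<phi> z \<eta> n = (v (real n) - v 0) / real n"
    using torsion_at_time_eq[OF assms(3)] by blast
  have "\<bar>(u (real n) - u 0) - (v (real n) - v 0)\<bar> \<le> pi" for n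
    using angle_lifts_bounded_difference[OF assms(1,3) u(1) v(1), of n]
      angle_lifts_bounded_difference[OF assms(3,1) v(1) u(1), of n] by linarith
  from bounded_over_n_tendsto_0[OF this]
  have "(\<lambda>n. torsion_at_time \<phi> z \<xi> n - torsion_at_time \<phi> z \<eta> n) \<longlonglongrightarrow> 0"
    unfolding u(2) v(2) diff_divide_distrib .
  then show ?thesis
    using LIMSEQ_unique[OF _ tendsto_diff[OF assms(2,4)]] by fastforce
qed

lemma torsion_limit_bounds:
  assumes twist: "\<forall>F x. is_lift F (\<phi> 1) \<longrightarrow> strict_mono (\<lambda>y. fst (F (x, y)))"
    and \<xi>: "\<xi> \<noteq> 0" and lim: "torsion_at_time \<phi> z \<xi> \<longlonglongrightarrow> \<tau>"
  shows "\<tau> \<in> {- pi..0}"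
proof -
  obtain v where v: "is_angle_lift \<phi> z \<xi> v"
    "\<And>n. torsion_at_time \<phi> z \<xi> n = (v (real n) - v 0) / real n"
    using torsion_at_time_eq[OF \<xi>] by blast
  have "torsion_at_time \<phi> z \<xi> n \<le> pi / real n \<and> - pi - pi / real n \<le> torsion_at_time \<phi> z \<xi> n"
    if "1 \<le> n" for n
  proof -
    have "(v (real n) - v 0) / real n \<le> pi / real n"
      by (intro divide_right_mono angle_lift_bounds(1)[OF twist \<xi> v(1)]) simp
    moreover have "(- (real n * pi) - pi) / real n \<le> (v (real n) - v 0) / real n"
      by (intro divide_right_mono angle_lift_bounds(2)[OF twist \<xi> v(1)]) simp
    moreover have "(- (real n * pi) - pi) / real n = - pi - pi / real n"
      using that by (simp add: field_simps)
    ultimately show ?thesis by (simp add: v(2))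
  qed
  then have ev: "\<forall>\<^sub>F n in sequentially. torsion_at_time \<phi> z \<xi> n \<le> pi / real n"
    "\<forall>\<^sub>F n in sequentially. - pi - pi / real n \<le> torsion_at_time \<phi> z \<xi> n"
    by (auto intro: eventually_sequentiallyI)
  have "\<tau> \<le> 0"
    by (rule tendsto_le[OF _ lim_const_over_n lim ev(1)]) simp
  moreover have "(\<lambda>n. - pi - pi / real n) \<longlonglongrightarrow> - pi - 0"
    by (intro tendsto_intros lim_const_over_n)
  then have "- pi \<le> \<tau>"
    using tendsto_le[OF _ lim _ ev(2)] by fastforce
  ultimately show ?thesis by simp
qed

end

theorem corollary1p1:
  fixes f :: "annulus \<Rightarrow> annulus" and \<phi> :: "real \<Rightarrow> annulus \<Rightarrow> annulus" and z :: annulus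
  assumes "positive_twist_map f"
    and "isotopy_from_id \<phi> f"
    and "torsion_exists \<phi> z"
  shows "torsion \<phi> z \<in> {- pi..0}"
proof -
  interpret annulus_isotopy \<phi>
    using assms(2) by unfold_locales (auto simp: isotopy_from_id_def)
  have twist: "\<forall>F x. is_lift F (\<phi> 1) \<longrightarrow> strict_mono (\<lambda>y. fst (F (x, y)))"
    using assms(1,2) by (simp add: positive_twist_map_def isotopy_from_id_def increasing_diffeo_def)
  obtain \<xi> \<tau> where \<xi>: "\<xi> \<noteq> 0" "torsion_at_time \<phi> z \<xi> \<longlonglongrightarrow> \<tau>"
    using assms(3) by (auto simp: torsion_exists_def convergent_def)
  then have "torsion \<phi> z = \<tau>"
    unfolding torsion_def using torsion_limit_unique by (intro the_equality) blast+
  then show ?thesis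
    using torsion_limit_bounds[OF twist \<xi>] by simp
qed

end
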